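(* Assume that $\mathcal{D}(A)\subset\mathcal{D}(Q^{-1/2})$, $|(-A)^{1/2}Q^{1/2}|_{\mathcal{L}_2(H)}<\infty$ and $|Q^{-1/2}(-A)^{-1}|_{\mathcal{L}(H)}<\infty$. Assume that $F\colon H\to H$ is Fréchet differentiable and that there exist $L_F,L>0$ such that $|F(u)-F(v)|\le L_F|u-v|$ for $u,v\in H$, $|F(u)|_{\dot H^1}\le L(1+|u|_{\dot H^1})$ for $u\in\dot H^1$, and $|F'(u)v|_{\dot H^2}\le L(1+|u|_{\dot H^2}^2)|v|_{\dot H^2}$ for $u,v\in\dot H^2$. Assume moreover that $F(0)=0$ and $L_F<\lambda_1$. If $F\equiv 0$, then the spectral Galerkin method weakly asymptotically preserves the large deviations principle of the invariant measures $\{\mu^\varepsilon\}_{\varepsilon>0}$, that is: for any $\kappa>0$ and any $u\in H$ with $V(u)<\infty$, there exist $n\in\mathbb{N}^+$ and $u_n\in H_n$ such that $$|u-u_n|<\kappa,\qquad |V(u)-V^n(u_n)|<\kappa.$$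
   Context: $H:=L^2((0,1);\mathbb{R})$ with inner product $\langle\cdot,\cdot\rangle$ and norm $|\cdot|$; $\mathcal{L}(H)$ and $\mathcal{L}_2(H)$ are the bounded and the Hilbert–Schmidt operators on $H$. $A$ is the Dirichlet Laplacian on $(0,1)$, $\mathcal{D}(A)=H_0^1\cap H^2$; $e_i(\xi)=\sqrt2\sin(i\pi\xi)$ is an orthonormal basis of $H$ with $-Ae_i=\lambda_ie_i$, $\lambda_i=\pi^2i^2$. For $\gamma\in\mathbb{R}$, $\dot H^\gamma:=\mathcal{D}((-A)^{\gamma/2})$ with norm $|u|_{\dot H^\gamma}=|(-A)^{\gamma/2}u|$. $Q$ is a self-adjoint, positive definite bounded linear operator on $H$ with $Qe_i=q_ie_i$, $q_i>0$; $Q^{-1/2}\colon Q^{1/2}(H)\to H$ is the inverse of $Q^{1/2}$ and $\mathcal{D}(Q^{-1/2})=Q^{1/2}(H)$. $\mu^\varepsilon$ is an invariant measure of the SPDE $dX=(AX+F(X))dt+\varepsilon Q^{1/2}dW$ on $H$ ($W$ a cylindrical Wiener process); the family $\{\mu^\varepsilon\}$ satisfies a large deviations principle on $H$ with rate $1/\varepsilon^2$ and good rate function $$V(u)=\inf\{I_{0,T}^0(z):T>0,\ z\in C([0,T];H),\ z(0)=0,\ z(T)=u\},\quad u\in H,$$ where $I_{0,T}^x(z)=\tfrac12\inf\{|\varphi|_{L^2(0,T;H)}^2:\varphi\in L^2(0,T;H),\ z_{0,x}^\varphi=z\}$ and $z_{0,x}^\varphi$ is the mild solution of $\frac{dz}{dt}=Az+F(z)+Q^{1/2}\varphi$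 on $(0,T]$, $z(0)=x$. For $n\in\mathbb{N}^+$: $H_n:=\mathrm{span}\{e_1,\dots,e_n\}$, $P_n$ is the orthogonal projection of $H$ onto $H_n$, $A_n:=P_nA$ (on $H_n$), $F_n:=P_nF$, $Q_n^{1/2}:=P_nQ^{1/2}$. The spectral Galerkin method is $dX^{\varepsilon,n}=(A_nX^{\varepsilon,n}+F_n(X^{\varepsilon,n}))dt+\varepsilon Q_n^{1/2}d(P_nW)$. The rate function of its invariant measures is $$V^n(v)=\inf\{I_{0,T}^{n,0}(z):T>0,\ z\in C([0,T];H_n),\ z(0)=0,\ z(T)=v\},\quad v\in H_n,$$ where $I_{0,T}^{n,y}(z)=\tfrac12\inf\{|\psi|_{L^2(0,T;H)}^2:\psi\in L^2(0,T;H_n),\ z_{0,y}^{n,\psi}=z\}$ and $z_{0,y}^{n,\psi}$ is the mild solution of $\frac{dz}{dt}=A_nz+F_n(z)+Q_n^{1/2}\psi$ on $(0,T]$, $z(0)=y$. All infima over the empty set are $+\infty$. *)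

theory Defs
  imports "HOL-Analysis.Analysis"
begin

subsection \<open>The Hilbert space \<open>H = L\<^sup>2((0,1))\<close>\<close>

definition M01 :: "real measure" where
  "M01 = lebesgue_on {0<..<1}"

definition sq_int :: "(real \<Rightarrow> real) \<Rightarrow> bool" where
  "sq_int f \<longleftrightarrow> f \<in> borel_measurable M01 \<and> integrable M01 (\<lambda>x. (f x)\<^sup>2)"

lemma sq_int_zero: "sq_int (\<lambda>x. 0)"
  by (simp add: sq_int_def)

lemma sq_int_mult:
  assumes "sq_int f" "sq_int g"
  shows "integrable M01 (\<lambda>x. f x * g x)"
proof (rule Bochner_Integration.integrable_bound)
  show "integrable M01 (\<lambda>x. (f x)\<^sup>2 + (g x)\<^sup>2)"
    using assms by (simp add: sq_int_def)
  have "\<bar>f x\<bar> * \<bar>g x\<bar> \<le> (f x)\<^sup>2 + (g x)\<^sup>2" for x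
  proof -
    have "0 \<le> (\<bar>f x\<bar> - \<bar>g x\<bar>)\<^sup>2" "0 \<le> \<bar>f x\<bar> * \<bar>g x\<bar>" by simp_all
    then show ?thesis unfolding power2_diff power2_abs by linarith
  qed
  then show "AE x in M01. norm (f x * g x) \<le> norm ((f x)\<^sup>2 + (g x)\<^sup>2)"
    by (auto simp: abs_mult)
qed (use assms in \<open>auto simp: sq_int_def\<close>)

lemma sq_int_add:
  assumes "sq_int f" "sq_int g"
  shows "sq_int (\<lambda>x. f x + g x)"
  using assms sq_int_mult[OF assms]
  by (auto simp: sq_int_def power2_sum mult.assoc)

lemma sq_int_scale:
  assumes "sq_int f" shows "sq_int (\<lambda>x. c * f x)"
  using assms by (auto simp: sq_int_def power_mult_distrib)

definition ae_eq :: "(real \<Rightarrow> real) \<Rightarrow> (real \<Rightarrow> real) \<Rightarrow> bool" where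
  "ae_eq f g \<longleftrightarrow> sq_int f \<and> sq_int g \<and> (AE x in M01. f x = g x)"

text \<open>Square-integrable functions modulo equality almost everywhere.\<close>

quotient_type L2 = "real \<Rightarrow> real" / partial: ae_eq
proof (rule part_equivpI)
  show "\<exists>x. ae_eq x x"
    by (rule exI[of _ "\<lambda>x. 0"]) (simp add: ae_eq_def sq_int_zero)
  show "symp ae_eq"
    by (rule sympI) (auto simp: ae_eq_def)
  show "transp ae_eq"
    by (rule transpI) (auto simp: ae_eq_def)
qed

lemma L2_cases:
  obtains f where "sq_int f" "u = abs_L2 f"
proof -
  have "ae_eq (rep_L2 u) (rep_L2 u)" "abs_L2 (rep_L2 u) = u"
    using Quotient_rep_reflp[OF Quotient_L2] Quotient_abs_rep[OF Quotient_L2] by auto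
  then show thesis using that[of "rep_L2 u"] by (simp add: ae_eq_def)
qed

lemma ae_eq_iff: "sq_int f \<Longrightarrow> sq_int g \<Longrightarrow> abs_L2 f = abs_L2 g \<longleftrightarrow> (AE x in M01. f x = g x)"
  using Quotient_rel[OF Quotient_L2, of f g] by (simp add: ae_eq_def)

instantiation L2 :: real_inner
begin

lift_definition zero_L2 :: L2 is "\<lambda>x. 0"
  by (simp add: ae_eq_def sq_int_zero)

lift_definition plus_L2 :: "L2 \<Rightarrow> L2 \<Rightarrow> L2" is "\<lambda>f g x. f x + g x"
  by (auto simp: ae_eq_def sq_int_add)

lift_definition scaleR_L2 :: "real \<Rightarrow> L2 \<Rightarrow> L2" is "\<lambda>c f x. c * f x"
  by (auto simp: ae_eq_def sq_int_scale)

definition uminus_L2 :: "L2 \<Rightarrow> L2" where "uminus_L2 u = (-1) *\<^sub>R u"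

definition minus_L2 :: "L2 \<Rightarrow> L2 \<Rightarrow> L2" where "minus_L2 u v = u + - v"

lift_definition inner_L2 :: "L2 \<Rightarrow> L2 \<Rightarrow> real" is "\<lambda>f g. integral\<^sup>L M01 (\<lambda>x. f x * g x)"
proof -
  fix f1 f2 g1 g2 assume a: "ae_eq f1 f2" "ae_eq g1 g2"
  show "integral\<^sup>L M01 (\<lambda>x. f1 x * g1 x) = integral\<^sup>L M01 (\<lambda>x. f2 x * g2 x)"
  proof (rule integral_cong_AE)
    show "AE x in M01. f1 x * g1 x = f2 x * g2 x"
      using a by (auto simp: ae_eq_def)
  qed (use a in \<open>auto simp: ae_eq_def sq_int_def\<close>)
qed

definition norm_L2 :: "L2 \<Rightarrow> real" where "norm_L2 u = sqrt (u \<bullet> u)"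
definition sgn_L2 :: "L2 \<Rightarrow> L2" where "sgn_L2 u = inverse (norm u) *\<^sub>R u"
definition dist_L2 :: "L2 \<Rightarrow> L2 \<Rightarrow> real" where "dist_L2 u v = norm (u - v)"
definition uniformity_L2 :: "(L2 \<times> L2) filter" where
  "uniformity_L2 = (INF e\<in>{0 <..}. principal {(x, y). dist x y < e})"
definition open_L2 :: "L2 set \<Rightarrow> bool" where
  "open_L2 U \<longleftrightarrow> (\<forall>x\<in>U. eventually (\<lambda>(x', y). x' = x \<longrightarrow> y \<in> U) uniformity)"

instance
proof
  fix u v w :: L2 and a b :: real
  show "u + v + w = u + (v + w)"
    by transfer (auto simp: ae_eq_def add.assoc intro!: sq_int_add)
  show "u + v = v + u"
    by transfer (auto simp: ae_eq_def add.commute intro!: sq_int_add)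
  show "0 + u = u"
    by transfer (auto simp: ae_eq_def)
  show "- u + u = 0"
    unfolding uminus_L2_def
    by transfer (auto simp: ae_eq_def sq_int_zero)
  show "u - v = u + - v" by (rule minus_L2_def)
  show "a *\<^sub>R (u + v) = a *\<^sub>R u + a *\<^sub>R v"
    by transfer (auto simp: ae_eq_def distrib_left intro!: sq_int_add sq_int_scale)
  show "(a + b) *\<^sub>R u = a *\<^sub>R u + b *\<^sub>R u"
    by transfer (auto simp: ae_eq_def distrib_right intro!: sq_int_add sq_int_scale)
  show "a *\<^sub>R b *\<^sub>R u = (a * b) *\<^sub>R u"
    by transfer (auto simp: ae_eq_def mult.assoc intro!: sq_int_scale)
  show "1 *\<^sub>R u = u"
    by transfer (auto simp: ae_eq_def)
  show "dist u v = norm (u - v)" by (rule dist_L2_def)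
  show "sgn u = inverse (norm u) *\<^sub>R u" by (rule sgn_L2_def)
  show "uniformity = (INF e\<in>{0<..}. principal {(x, y::L2). dist x y < e})"
    by (rule uniformity_L2_def)
  show "open U \<longleftrightarrow> (\<forall>x\<in>U. eventually (\<lambda>(x', y). x' = x \<longrightarrow> y \<in> U) uniformity)" for U :: "L2 set"
    by (rule open_L2_def)
  show "u \<bullet> v = v \<bullet> u"
    by transfer (simp add: mult.commute)
  show "(u + v) \<bullet> w = u \<bullet> w + v \<bullet> w"
    by transfer (auto simp: ae_eq_def distrib_right sq_int_mult)
  show "(a *\<^sub>R u) \<bullet> v = a * (u \<bullet> v)"
    by transfer (auto simp: mult.assoc)
  show "0 \<le> u \<bullet> u"
    by transfer auto
  show "u \<bullet> u = 0 \<longleftrightarrow> u = 0"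
    by transfer
       (auto simp: ae_eq_def sq_int_zero integral_nonneg_eq_0_iff_AE sq_int_mult)
  show "norm u = sqrt (u \<bullet> u)" by (rule norm_L2_def)
qed

end

lemma inner_abs_L2: "sq_int f \<Longrightarrow> sq_int g \<Longrightarrow> abs_L2 f \<bullet> abs_L2 g = (LINT x|M01. f x * g x)"
  by (rule inner_L2.abs_eq) (simp_all add: ae_eq_def)

lemma plus_abs_L2: "sq_int f \<Longrightarrow> sq_int g \<Longrightarrow> abs_L2 f + abs_L2 g = abs_L2 (\<lambda>x. f x + g x)"
  by (rule plus_L2.abs_eq) (simp_all add: ae_eq_def)

lemma scaleR_abs_L2: "sq_int f \<Longrightarrow> c *\<^sub>R abs_L2 f = abs_L2 (\<lambda>x. c * f x)"
  by (rule scaleR_L2.abs_eq) (simp_all add: ae_eq_def)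

lemma diff_abs_L2: "sq_int f \<Longrightarrow> sq_int g \<Longrightarrow> abs_L2 f - abs_L2 g = abs_L2 (\<lambda>x. f x - g x)"
  using plus_abs_L2[of f "\<lambda>x. -1 * g x"] scaleR_abs_L2[of g "-1"] sq_int_scale[of g "-1"]
  by (simp del: add_uminus_conv_diff add: diff_conv_add_uminus)

lemma norm_abs_L2: "sq_int f \<Longrightarrow> norm (abs_L2 f) = sqrt (LINT x|M01. (f x)\<^sup>2)"
  by (simp add: norm_L2_def inner_abs_L2 power2_eq_square)

subsection \<open>Completeness (Riesz--Fischer)\<close>

lemma space_M01 [simp]: "space M01 = {0<..<1}"
  by (simp add: M01_def)

lemma finite_measure_M01: "finite_measure M01"
  by (rule finite_measureI) (simp add: M01_def emeasure_restrict_space)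

lemma sq_int_const: "sq_int (\<lambda>x. c)"
  using finite_measure.integrable_const[OF finite_measure_M01] by (simp add: sq_int_def)

lemma sq_int_diff:
  assumes "sq_int f" "sq_int g" shows "sq_int (\<lambda>x. f x - g x)"
  using sq_int_add[OF assms(1) sq_int_scale[OF assms(2), of "-1"]] by simp

lemma sq_int_abs: "sq_int f \<Longrightarrow> sq_int (\<lambda>x. \<bar>f x\<bar>)"
  by (auto simp: sq_int_def)

lemma sq_int_integrable: "sq_int f \<Longrightarrow> integrable M01 f"
  using sq_int_mult[OF _ sq_int_const[of 1]] by simp

lemma measure_M01: "measure M01 {0<..<1} = 1"
  by (simp add: M01_def measure_restrict_space)

lemma integral_le_norm_L2:
  assumes "sq_int f" shows "(LINT x|M01. \<bar>f x\<bar>) \<le> norm (abs_L2 f)"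
proof -
  have abs: "sq_int (\<lambda>x. \<bar>f x\<bar>)" by (rule sq_int_abs[OF assms])
  have "(LINT x|M01. \<bar>f x\<bar>) = abs_L2 (\<lambda>x. \<bar>f x\<bar>) \<bullet> abs_L2 (\<lambda>x. 1)"
    by (subst inner_abs_L2[OF abs sq_int_const]) simp
  also have "\<dots> \<le> norm (abs_L2 (\<lambda>x. \<bar>f x\<bar>)) * norm (abs_L2 (\<lambda>x. 1))"
    by (rule norm_cauchy_schwarz)
  also have "\<dots> = norm (abs_L2 f)"
    using assms abs by (simp add: norm_abs_L2 sq_int_const measure_M01)
  finally show ?thesis .
qed

lemma ennreal_norm_L2:
  assumes "sq_int f"
  shows "(\<integral>\<^sup>+x. ennreal ((f x)\<^sup>2) \<partial>M01) = ennreal ((norm (abs_L2 f))\<^sup>2)"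
  using assms by (simp add: norm_abs_L2 nn_integral_eq_integral sq_int_def)

instance L2 :: banach
proof
  fix X :: "nat \<Rightarrow> L2" assume C: "Cauchy X"
  have "\<exists>n. \<forall>m\<ge>n. \<forall>k\<ge>n. norm (X m - X k) < (1/2) ^ j" for j :: nat
    using CauchyD[OF C, of "(1/2)^j"] by auto
  then obtain N where N: "\<And>j m k. N j \<le> m \<Longrightarrow> N j \<le> k \<Longrightarrow> norm (X m - X k) < (1/2) ^ j"
    by metis
  define r where "r n = (\<Sum>j\<le>n. N j) + n" for n
  have rN: "N n \<le> r n" for n
    unfolding r_def by (simp add: member_le_sum trans_le_add1)
  have "strict_mono r"
    by (rule strict_monoI_Suc) (simp add: r_def)
  have "\<exists>f. sq_int f \<and> X (r n) = abs_L2 f" for n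
    by (rule L2_cases[of "X (r n)"]) auto
  then obtain f where sf: "\<And>n. sq_int (f n)" and Xf: "\<And>n. X (r n) = abs_L2 (f n)"
    by metis
  have fm [measurable]: "f n \<in> borel_measurable M01" for n
    using sf by (simp add: sq_int_def)
  have close: "norm (abs_L2 (\<lambda>x. f m x - f n x)) \<le> (1/2) ^ n" if "n \<le> m" for m n
  proof -
    have "r n \<le> r m" using that \<open>strict_mono r\<close> by (simp add: strict_mono_less_eq)
    then have "norm (X (r m) - X (r n)) < (1/2) ^ n"
      using N[of n "r m" "r n"] rN[of n] by simp
    then show ?thesis by (simp add: Xf diff_abs_L2 sf)
  qed
  have "(\<integral>\<^sup>+x. (\<Sum>n. ennreal \<bar>f (Suc n) x - f n x\<bar>) \<partial>M01)
        = (\<Sum>n. \<integral>\<^sup>+x. ennreal \<bar>f (Suc n) x - f n x\<bar> \<partial>M01)"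
    by (rule nn_integral_suminf) measurable
  also have "\<dots> \<le> (\<Sum>n. ennreal ((1/2) ^ n))"
  proof (rule suminf_le)
    fix n
    have "(\<integral>\<^sup>+x. ennreal \<bar>f (Suc n) x - f n x\<bar> \<partial>M01) = ennreal (LINT x|M01. \<bar>f (Suc n) x - f n x\<bar>)"
      by (rule nn_integral_eq_integral) (auto intro!: sq_int_integrable sq_int_abs sq_int_diff sf simp del: integrable_abs_iff)
    also have "\<dots> \<le> ennreal ((1/2) ^ n)"
      using integral_le_norm_L2[OF sq_int_diff[OF sf sf], of "Suc n" n] close[of n "Suc n"]
      by (intro ennreal_leI) simp
    finally show "(\<integral>\<^sup>+x. ennreal \<bar>f (Suc n) x - f n x\<bar> \<partial>M01) \<le> ennreal ((1/2) ^ n)" .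
  qed simp_all
  also have "\<dots> < \<infinity>"
    by (subst suminf_ennreal2) (auto simp: summable_geometric)
  finally have "AE x in M01. (\<Sum>n. ennreal \<bar>f (Suc n) x - f n x\<bar>) \<noteq> \<infinity>"
    by (intro nn_integral_PInf_AE) auto
  then have conv: "AE x in M01. convergent (\<lambda>n. f n x)"
  proof eventually_elim
    case (elim x)
    then have "summable (\<lambda>n. \<bar>f (Suc n) x - f n x\<bar>)"
      by (intro summable_suminf_not_top) (simp_all add: infinity_ennreal_def)
    then have "summable (\<lambda>n. f (Suc n) x - f n x)"
      by (rule summable_rabs_cancel)
    then have "convergent (\<lambda>n. (\<Sum>k<n. f (Suc k) x - f k x) + f 0 x)"
      by (intro convergent_add convergent_const) (simp add: summable_iff_convergent)
    then show "convergent (\<lambda>n. f n x)"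
      using sum_lessThan_telescope[of "\<lambda>n. f n x"] by simp
  qed
  define g where "g x = lim (\<lambda>n. f n x)" for x
  have gm [measurable]: "g \<in> borel_measurable M01"
    unfolding g_def by measurable
  have bound: "(\<integral>\<^sup>+x. ennreal ((g x - f n x)\<^sup>2) \<partial>M01) \<le> ennreal (((1/2) ^ n)\<^sup>2)" for n
  proof -
    have "(\<integral>\<^sup>+x. ennreal ((g x - f n x)\<^sup>2) \<partial>M01)
        = (\<integral>\<^sup>+x. liminf (\<lambda>m. ennreal ((f m x - f n x)\<^sup>2)) \<partial>M01)"
    proof (rule nn_integral_cong_AE)
      show "AE x in M01. ennreal ((g x - f n x)\<^sup>2) = liminf (\<lambda>m. ennreal ((f m x - f n x)\<^sup>2))"
        using conv
      proof eventually_elim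
        case (elim x)
        then have "(\<lambda>m. f m x) \<longlonglongrightarrow> g x"
          by (simp add: convergent_LIMSEQ_iff g_def)
        then have "(\<lambda>m. ennreal ((f m x - f n x)\<^sup>2)) \<longlonglongrightarrow> ennreal ((g x - f n x)\<^sup>2)"
          by (intro tendsto_intros) auto
        from lim_imp_Liminf[OF _ this] show ?case
          by simp
      qed
    qed
    also have "\<dots> \<le> liminf (\<lambda>m. \<integral>\<^sup>+x. ennreal ((f m x - f n x)\<^sup>2) \<partial>M01)"
      by (rule nn_integral_liminf) measurable
    also have "\<dots> \<le> liminf (\<lambda>m. ennreal (((1/2) ^ n)\<^sup>2))"
    proof (rule Liminf_mono)
      show "\<forall>\<^sub>F m in sequentially. (\<integral>\<^sup>+x. ennreal ((f m x - f n x)\<^sup>2) \<partial>M01) \<le> ennreal (((1/2) ^ n)\<^sup>2)"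
        using eventually_ge_at_top[of n]
      proof eventually_elim
        case (elim m)
        then show ?case
          by (subst ennreal_norm_L2) (auto intro!: sq_int_diff sf ennreal_leI power_mono close)
      qed
    qed
    also have "\<dots> = ennreal (((1/2) ^ n)\<^sup>2)"
      by (simp add: Liminf_const)
    finally show ?thesis .
  qed
  have sd: "sq_int (\<lambda>x. g x - f n x)" for n
    unfolding sq_int_def
    by (auto intro!: integrableI_bounded le_less_trans[OF bound])
  have sg: "sq_int g"
    using sq_int_add[OF sd sf, of 0 0] by simp
  have "norm (X (r n) - abs_L2 g) \<le> (1/2) ^ n" for n
  proof -
    have "ennreal ((norm (abs_L2 (\<lambda>x. g x - f n x)))\<^sup>2) \<le> ennreal (((1/2) ^ n)\<^sup>2)"
      using bound[of n] by (simp add: ennreal_norm_L2 sd)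
    then have "(norm (abs_L2 (\<lambda>x. g x - f n x)))\<^sup>2 \<le> ((1/2) ^ n)\<^sup>2"
      by (subst (asm) ennreal_le_iff) simp_all
    then have "norm (abs_L2 (\<lambda>x. g x - f n x)) \<le> (1/2) ^ n"
      by (rule power2_le_imp_le) simp
    then show ?thesis
      by (subst norm_minus_commute) (simp add: Xf diff_abs_L2 sf sg)
  qed
  moreover have "(\<lambda>n. (1/2::real) ^ n) \<longlonglongrightarrow> 0"
    by (rule LIMSEQ_power_zero) simp
  ultimately have "(\<lambda>n. X (r n) - abs_L2 g) \<longlonglongrightarrow> 0"
    by (rule Lim_null_comparison[OF always_eventually[OF allI]])
  then have "(X \<circ> r) \<longlonglongrightarrow> abs_L2 g"
    unfolding comp_def by (rule LIM_zero_cancel)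
  from Cauchy_converges_subseq[OF C \<open>strict_mono r\<close> this] show "convergent X"
    by (rule convergentI)
qed

subsection \<open>Calculus on \<open>(0,1)\<close> and completeness of the sine system\<close>

lemma continuous_measurable_M01:
  "continuous_on {0..1} f \<Longrightarrow> f \<in> borel_measurable M01"
  unfolding M01_def
  by (rule continuous_imp_measurable_on_sets_lebesgue) (auto intro: continuous_on_subset)

lemma continuous_bounded_01:
  fixes f :: "real \<Rightarrow> real"
  assumes "continuous_on {0..1} f"
  obtains B where "\<And>x. x \<in> {0..1} \<Longrightarrow> \<bar>f x\<bar> \<le> B"
proof -
  have "bounded (f ` {0..1})"
    by (intro compact_imp_bounded compact_continuous_image assms) simp
  then obtain B where "\<forall>x\<in>{0..1}. \<bar>f x\<bar> \<le> B"
    unfolding bounded_iff by auto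
  then show thesis
    using that by blast
qed

lemma sq_int_bounded:
  assumes "f \<in> borel_measurable M01" "\<And>x. x \<in> {0<..<1} \<Longrightarrow> \<bar>f x\<bar> \<le> B"
  shows "sq_int f"
  unfolding sq_int_def
proof
  show "integrable M01 (\<lambda>x. (f x)\<^sup>2)"
  proof (rule finite_measure.integrable_const_bound[OF finite_measure_M01])
    show "AE x in M01. norm ((f x)\<^sup>2) \<le> B\<^sup>2"
      using assms(2) by (auto intro!: AE_I2 abs_le_square_iff[THEN iffD1] order_trans[OF _ abs_ge_self])
  qed (use assms in measurable)
qed (rule assms)

lemma sq_int_continuous:
  assumes "continuous_on {0..1} f" shows "sq_int f"
proof -
  obtain B where "\<And>x. x \<in> {0..1} \<Longrightarrow> \<bar>f x\<bar> \<le> B"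
    using continuous_bounded_01[OF assms] by blast
  then show ?thesis
    by (intro sq_int_bounded[of _ B] continuous_measurable_M01 assms) auto
qed

lemma LINT_FTC:
  fixes F f :: "real \<Rightarrow> real"
  assumes "\<And>x. x \<in> {0..1} \<Longrightarrow> (F has_real_derivative f x) (at x)" and c: "continuous_on {0..1} f"
  shows "(LINT x|M01. f x) = F 1 - F 0"
proof -
  have "(f has_integral (F 1 - F 0)) {0..1}"
    using assms(1)
    by (intro fundamental_theorem_of_calculus)
       (auto simp: has_real_derivative_iff_has_vector_derivative[symmetric] intro: has_field_derivative_at_within)
  then have "(f has_integral (F 1 - F 0)) {0<..<1}"
    by (simp add: has_integral_Icc_iff_Ioo)
  moreover have "(f has_integral (LINT x|M01. f x)) {0<..<1}"
    unfolding M01_def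
    using sq_int_integrable[OF sq_int_continuous[OF c]]
    by (intro has_integral_integral_lebesgue_on) (auto simp: M01_def)
  ultimately show ?thesis
    using has_integral_unique by blast
qed

lemma LINT_by_parts:
  fixes f g :: "real \<Rightarrow> real"
  assumes f: "\<And>x. (f has_real_derivative f' x) (at x)" and g: "\<And>x. (g has_real_derivative g' x) (at x)"
    and c: "continuous_on {0..1} f'" "continuous_on {0..1} g'"
  shows "(LINT x|M01. f' x * g x) = f 1 * g 1 - f 0 * g 0 - (LINT x|M01. f x * g' x)"
proof -
  have cf: "continuous_on {0..1} f" "continuous_on {0..1} g"
    using f g by (auto intro!: DERIV_isCont continuous_at_imp_continuous_on)
  have "(LINT x|M01. f' x * g x + f x * g' x) = f 1 * g 1 - f 0 * g 0"
    by (rule LINT_FTC[of "\<lambda>x. f x * g x"])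
       (auto intro!: derivative_eq_intros f g continuous_intros c cf)
  moreover have "(LINT x|M01. f' x * g x + f x * g' x) = (LINT x|M01. f' x * g x) + (LINT x|M01. f x * g' x)"
    by (intro Bochner_Integration.integral_add sq_int_mult sq_int_continuous c cf)
  ultimately show ?thesis by simp
qed

inductive_set sinspan :: "(real \<Rightarrow> real) set" where
  sin: "(\<lambda>x. sin (real k * pi * x)) \<in> sinspan"
| add: "w \<in> sinspan \<Longrightarrow> z \<in> sinspan \<Longrightarrow> (\<lambda>x. w x + z x) \<in> sinspan"
| scale: "w \<in> sinspan \<Longrightarrow> (\<lambda>x. c * w x) \<in> sinspan"

lemma sinspan_cos:
  assumes "w \<in> sinspan" shows "(\<lambda>x. cos (pi * x) * w x) \<in> sinspan"
  using assms
proof induction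
  case (sin k)
  show ?case
  proof (cases k)
    case 0
    then show ?thesis using sinspan.sin[of 0] by simp
  next
    case (Suc m)
    have "(\<lambda>x. 1/2 * (sin (real (k + 1) * pi * x) + sin (real m * pi * x))) \<in> sinspan"
      by (intro sinspan.intros)
    also have "(\<lambda>x. 1/2 * (sin (real (k + 1) * pi * x) + sin (real m * pi * x)))
             = (\<lambda>x. cos (pi * x) * sin (real k * pi * x))"
    proof
      fix x
      have "sin (real (k + 1) * pi * x) = sin (real k * pi * x + pi * x)"
        by (simp add: algebra_simps)
      moreover have "sin (real m * pi * x) = sin (real k * pi * x - pi * x)"
        by (simp add: Suc algebra_simps)
      ultimately show "1/2 * (sin (real (k + 1) * pi * x) + sin (real m * pi * x))
          = cos (pi * x) * sin (real k * pi * x)"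
        by (simp add: sin_add sin_diff)
    qed
    finally show ?thesis .
  qed
next
  case (add w z)
  then show ?case
    using sinspan.add[OF add.IH] by (simp add: distrib_left)
next
  case (scale w c)
  then show ?case
    using sinspan.scale[OF scale.IH, of c] by (simp add: mult.left_commute)
qed

lemma sinspan_continuous: "w \<in> sinspan \<Longrightarrow> continuous_on A w"
  by (induction rule: sinspan.induct) (auto intro!: continuous_intros)

lemma sine_complete_fun:
  assumes f: "sq_int f" and orth: "\<And>k. (LINT x|M01. f x * sin (real k * pi * x)) = 0"
  shows "AE x in M01. f x = 0"
proof -
  have fm [measurable]: "f \<in> borel_measurable M01" using f by (simp add: sq_int_def)
  have orth_span: "(LINT x|M01. f x * w x) = 0" if "w \<in> sinspan" for w
    using that
  proof induction
    case (add w z)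
    have "(LINT x|M01. f x * (w x + z x)) = (LINT x|M01. f x * w x) + (LINT x|M01. f x * z x)"
      unfolding distrib_left
      by (intro Bochner_Integration.integral_add sq_int_mult f sq_int_continuous sinspan_continuous add)
    then show ?case using add by simp
  next
    case (scale w c)
    then show ?case by (simp add: mult.left_commute)
  qed (rule orth)
  define R where "R = {p. continuous_on {0..1} p \<and> (\<forall>w\<in>sinspan. (\<lambda>x. p x * w x) \<in> sinspan)}"
  interpret function_ring_on R "{0..1::real}"
  proof unfold_locales
    show "\<exists>p\<in>R. p x \<noteq> p y" if "x \<in> {0..1}" "y \<in> {0..1}" "x \<noteq> y" for x y :: real
    proof
      show "cos (pi * x) \<noteq> cos (pi * y)"
      proof
        assume "cos (pi * x) = cos (pi * y)"
        with that have "pi * x = pi * y"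
          by - (rule cos_inj_pi, auto intro!: mult_left_le)
        then show False using that by simp
      qed
      show "(\<lambda>x. cos (pi * x)) \<in> R"
        by (auto simp: R_def intro!: sinspan_cos continuous_intros)
    qed
    show "(\<lambda>x. p x + q x) \<in> R" if "p \<in> R" "q \<in> R" for p q
      using that by (auto simp: R_def distrib_right intro!: sinspan.add continuous_intros)
    show "(\<lambda>x. p x * q x) \<in> R" if "p \<in> R" "q \<in> R" for p q
      using that by (auto simp: R_def mult.assoc intro!: continuous_intros)
    show "(\<lambda>_. c) \<in> R" for c
      by (auto simp: R_def intro!: sinspan.scale)
  qed (auto simp: R_def)
  define h where "h x = f x * sin (pi * x)" for x
  have s1: "(\<lambda>x. sin (pi * x)) \<in> sinspan" using sinspan.sin[of 1] by simp
  have hs: "sq_int h"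
    unfolding sq_int_def
  proof
    show hm: "h \<in> borel_measurable M01"
      unfolding h_def
      by (intro borel_measurable_times fm continuous_measurable_M01 continuous_intros)
    show "integrable M01 (\<lambda>x. (h x)\<^sup>2)"
    proof (rule Bochner_Integration.integrable_bound)
      show "integrable M01 (\<lambda>x. (f x)\<^sup>2)" using f by (simp add: sq_int_def)
      show "(\<lambda>x. (h x)\<^sup>2) \<in> borel_measurable M01" using hm by measurable
      show "AE x in M01. norm ((h x)\<^sup>2) \<le> norm ((f x)\<^sup>2)"
        by (auto simp: h_def power_mult_distrib abs_square_le_1 intro!: AE_I2 mult_left_le)
    qed
  qed
  then have hm [measurable]: "h \<in> borel_measurable M01" by (simp add: sq_int_def)
  define K where "K = (LINT x|M01. \<bar>h x\<bar>)"
  have K0: "K \<ge> 0" unfolding K_def by simp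
  have hcont: "(LINT x|M01. h x * g x) = 0" if g: "continuous_on {0..1} g" for g
  proof -
    have "\<bar>LINT x|M01. h x * g x\<bar> \<le> d * K" if "d > 0" for d
    proof -
      obtain p where p: "p \<in> R" and pd: "\<And>x. x \<in> {0..1} \<Longrightarrow> \<bar>g x - p x\<bar> < d"
        using Stone_Weierstrass_basic[OF g \<open>d > 0\<close>] by blast
      have cp: "continuous_on {0..1} p" using p by (simp add: R_def)
      have "(\<lambda>x. p x * sin (pi * x)) \<in> sinspan"
        using p s1 by (auto simp: R_def)
      from orth_span[OF this] have "(LINT x|M01. h x * p x) = 0"
        by (simp add: h_def mult_ac)
      then have "(LINT x|M01. h x * g x) = (LINT x|M01. h x * g x) - (LINT x|M01. h x * p x)"
        by simp
      also have "\<dots> = (LINT x|M01. h x * (g x - p x))"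
        unfolding right_diff_distrib
        by (rule Bochner_Integration.integral_diff[symmetric])
           (intro sq_int_mult hs sq_int_continuous g cp)+
      also have "\<bar>\<dots>\<bar> \<le> (LINT x|M01. \<bar>h x * (g x - p x)\<bar>)"
        by (rule integral_abs_bound)
      also have "\<dots> \<le> (LINT x|M01. d * \<bar>h x\<bar>)"
      proof (rule integral_mono)
        show "integrable M01 (\<lambda>x. \<bar>h x * (g x - p x)\<bar>)"
          by (intro integrable_abs sq_int_mult hs sq_int_continuous continuous_intros g cp)
        show "integrable M01 (\<lambda>x. d * \<bar>h x\<bar>)"
          by (intro integrable_mult_right integrable_abs sq_int_integrable hs)
        show "\<bar>h x * (g x - p x)\<bar> \<le> d * \<bar>h x\<bar>" if "x \<in> space M01" for x
          using mult_left_mono[OF less_imp_le[OF pd[of x]], of "\<bar>h x\<bar>"] that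
          by (simp add: abs_mult mult.commute)
      qed
      also have "\<dots> = d * K" by (simp add: K_def)
      finally show ?thesis .
    qed
    note bd = this
    show ?thesis
    proof (rule ccontr)
      assume "(LINT x|M01. h x * g x) \<noteq> 0"
      then have pos: "\<bar>LINT x|M01. h x * g x\<bar> > 0" by simp
      from bd[of "\<bar>LINT x|M01. h x * g x\<bar> / (K + 1)"] pos K0
      have "\<bar>LINT x|M01. h x * g x\<bar> \<le> \<bar>LINT x|M01. h x * g x\<bar> / (K + 1) * K" by simp
      then have "\<bar>LINT x|M01. h x * g x\<bar> * (K + 1) \<le> \<bar>LINT x|M01. h x * g x\<bar> * K"
        using K0 by (simp add: field_simps)
      with pos show False by (simp add: distrib_left)
    qed
  qed
  have "(\<lambda>x. sgn (h x)) measurable_on {0<..<1}"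
    using hm unfolding M01_def by (simp add: measurable_on_iff_borel_measurable)
  then obtain N g where N: "negligible N" and g: "\<And>n. continuous_on UNIV (g n)"
    and lim: "\<And>x. x \<notin> N \<Longrightarrow> (\<lambda>n. g n x) \<longlonglongrightarrow> (if x \<in> {0<..<1} then sgn (h x) else 0)"
    unfolding measurable_on_def by blast
  define G where "G n x = max (-1) (min 1 (g n x))" for n :: nat and x :: real
  have cG: "continuous_on A (G n)" for n A
    unfolding G_def by (intro continuous_intros continuous_on_subset[OF g]) auto
  have AE_N: "AE x in M01. x \<notin> N"
    unfolding M01_def using N
    by (subst AE_restrict_space_iff)
       (auto simp: negligible_iff_null_sets intro: AE_not_in eventually_mono)
  have "(\<lambda>n. LINT x|M01. h x * G n x) \<longlonglongrightarrow> (LINT x|M01. \<bar>h x\<bar>)"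
  proof (rule integral_dominated_convergence)
    show "(\<lambda>x. h x * G n x) \<in> borel_measurable M01" for n
      by (intro borel_measurable_times hm continuous_measurable_M01 cG)
    show "integrable M01 (\<lambda>x. \<bar>h x\<bar>)"
      by (intro integrable_abs sq_int_integrable hs)
    show "AE x in M01. norm (h x * G n x) \<le> \<bar>h x\<bar>" for n
      by (auto simp: abs_mult G_def intro!: AE_I2 mult_left_le)
    show "AE x in M01. (\<lambda>n. h x * G n x) \<longlonglongrightarrow> \<bar>h x\<bar>"
      using AE_N AE_space
    proof eventually_elim
      case (elim x)
      then have "(\<lambda>n. g n x) \<longlonglongrightarrow> sgn (h x)" using lim[of x] by simp
      then have "(\<lambda>n. h x * G n x) \<longlonglongrightarrow> h x * max (-1) (min 1 (sgn (h x)))"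
        unfolding G_def by (intro tendsto_intros)
      also have "h x * max (-1) (min 1 (sgn (h x))) = \<bar>h x\<bar>"
        by (auto simp: sgn_if)
      finally show ?case .
    qed
  qed measurable
  then have "(\<lambda>n::nat. 0) \<longlonglongrightarrow> (LINT x|M01. \<bar>h x\<bar>)"
    by (simp add: hcont cG)
  then have "(LINT x|M01. \<bar>h x\<bar>) = 0"
    unfolding LIMSEQ_const_iff by simp
  then have "AE x in M01. \<bar>h x\<bar> = 0"
    by (subst (asm) integral_nonneg_eq_0_iff_AE) (auto intro: integrable_abs sq_int_integrable hs)
  then show ?thesis
    using AE_space
  proof eventually_elim
    case (elim x)
    then have "sin (pi * x) > 0" by (intro sin_gt_zero) auto
    with elim show ?case by (simp add: h_def)
  qed
qed

subsection \<open>The sine basis\<close>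

text \<open>The sequences below are meaningful for indices \<open>i \<ge> 1\<close>; note \<open>ebasis 0 = 0\<close>. \<open>dbasis i\<close> is the
  derivative of \<open>ebasis i\<close> on \<open>(0,1)\<close>.\<close>

definition ebasis :: "nat \<Rightarrow> L2" where
  "ebasis i = abs_L2 (\<lambda>x. sqrt 2 * sin (real i * pi * x))"

definition eigval :: "nat \<Rightarrow> real" where
  "eigval i = pi\<^sup>2 * (real i)\<^sup>2"

definition dbasis :: "nat \<Rightarrow> L2" where
  "dbasis i = abs_L2 (\<lambda>x. sqrt 2 * (real i * pi) * cos (real i * pi * x))"

lemma sq_int_ebasis: "sq_int (\<lambda>x. sqrt 2 * sin (real i * pi * x))"
  by (intro sq_int_continuous continuous_intros)

lemma sq_int_dbasis: "sq_int (\<lambda>x. sqrt 2 * (real i * pi) * cos (real i * pi * x))"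
  by (intro sq_int_continuous continuous_intros)

lemma eigval_pos: "i \<ge> 1 \<Longrightarrow> eigval i > 0"
  by (simp add: eigval_def)

lemma dbasis_inner: "dbasis i \<bullet> dbasis j = eigval i * (ebasis i \<bullet> ebasis j)"
proof -
  let ?e = "\<lambda>i x. sqrt 2 * sin (real i * pi * x)"
  let ?d = "\<lambda>i x. sqrt 2 * (real i * pi) * cos (real i * pi * x)"
  have "(LINT x|M01. ?d j x * ?d i x)
      = ?e j 1 * ?d i 1 - ?e j 0 * ?d i 0 - (LINT x|M01. ?e j x * (- eigval i * ?e i x))"
    by (rule LINT_by_parts)
       (auto intro!: derivative_eq_intros continuous_intros simp: eigval_def power2_eq_square)
  also have "(\<lambda>x. ?e j x * (- eigval i * ?e i x)) = (\<lambda>x. - eigval i * (?e i x * ?e j x))"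
    by (auto simp: fun_eq_iff)
  finally have "(LINT x|M01. ?d j x * ?d i x) = eigval i * (LINT x|M01. ?e i x * ?e j x)"
    by simp
  then show ?thesis
    unfolding dbasis_def ebasis_def
    by (subst inner_commute) (simp only: inner_abs_L2 sq_int_ebasis sq_int_dbasis)
qed

lemma ebasis_orthogonal:
  assumes "i \<noteq> j" shows "ebasis i \<bullet> ebasis j = 0"
proof -
  have "eigval i * (ebasis i \<bullet> ebasis j) = eigval j * (ebasis i \<bullet> ebasis j)"
    using dbasis_inner[of i j] dbasis_inner[of j i] by (simp add: inner_commute)
  moreover have "eigval i \<noteq> eigval j"
    using assms by (auto simp: eigval_def power2_eq_iff)
  ultimately show ?thesis by simp
qed

lemma sqrt2_mult: "(sqrt 2 * a) * (sqrt 2 * b) = 2 * (a * b)"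
proof -
  have "(sqrt 2 * a) * (sqrt 2 * b) = (sqrt 2 * sqrt 2) * (a * b)"
    by (simp only: mult_ac)
  then show ?thesis by simp
qed

lemma sincos_identity:
  "(p\<^sup>2 * k\<^sup>2) * ((sqrt 2 * s) * (sqrt 2 * s)) + (sqrt 2 * (k * p) * c) * (sqrt 2 * (k * p) * c)
    = 2 * (p\<^sup>2 * k\<^sup>2) * (s\<^sup>2 + c\<^sup>2)"
proof -
  have B: "(sqrt 2 * (k * p) * c) * (sqrt 2 * (k * p) * c) = 2 * ((k * p * c) * (k * p * c))"
    using sqrt2_mult[of "k * p * c" "k * p * c"] by (simp only: mult.assoc)
  show ?thesis
    unfolding sqrt2_mult B by (simp add: power2_eq_square algebra_simps)
qed

lemma ebasis_norm:
  assumes "i \<ge> 1" shows "ebasis i \<bullet> ebasis i = 1"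
proof -
  let ?e = "\<lambda>x. sqrt 2 * sin (real i * pi * x)"
  let ?d = "\<lambda>x. sqrt 2 * (real i * pi) * cos (real i * pi * x)"
  have "eigval i * (ebasis i \<bullet> ebasis i) + dbasis i \<bullet> dbasis i
      = (LINT x|M01. eigval i * (?e x * ?e x)) + (LINT x|M01. ?d x * ?d x)"
    unfolding dbasis_def ebasis_def
    by (simp only: inner_abs_L2 sq_int_ebasis sq_int_dbasis integral_mult_right_zero)
  also have "\<dots> = (LINT x|M01. eigval i * (?e x * ?e x) + ?d x * ?d x)"
    by (rule Bochner_Integration.integral_add[symmetric])
       (intro integrable_mult_right sq_int_mult sq_int_ebasis sq_int_dbasis)+
  also have "(\<lambda>x. eigval i * (?e x * ?e x) + ?d x * ?d x) = (\<lambda>x. 2 * eigval i)"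
  proof
    fix x
    show "eigval i * (?e x * ?e x) + ?d x * ?d x = 2 * eigval i"
      using sincos_identity[of pi "real i" "sin (real i * pi * x)" "cos (real i * pi * x)"]
      by (simp only: eigval_def sin_cos_squared_add mult.right_neutral)
  qed
  also have "(LINT x|M01. 2 * eigval i) = 2 * eigval i"
    by (simp add: measure_M01)
  finally show ?thesis
    using eigval_pos[OF assms] by (simp add: dbasis_inner)
qed

lemma ebasis_orthonormal:
  "ebasis (Suc i) \<bullet> ebasis (Suc j) = (if i = j then 1 else 0)"
  by (simp add: ebasis_norm ebasis_orthogonal)

lemma ebasis_complete:
  assumes "\<And>i. i \<ge> 1 \<Longrightarrow> u \<bullet> ebasis i = 0" shows "u = 0"
proof -
  obtain f where f: "sq_int f" and u: "u = abs_L2 f" by (rule L2_cases)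
  have "AE x in M01. f x = 0"
  proof (rule sine_complete_fun[OF f])
    fix k
    show "(LINT x|M01. f x * sin (real k * pi * x)) = 0"
    proof (cases "k \<ge> 1")
      case True
      have "(LINT x|M01. f x * (sqrt 2 * sin (real k * pi * x))) = 0"
        using assms[OF True] by (simp add: u ebasis_def inner_abs_L2 f sq_int_ebasis)
      also have "(\<lambda>x. f x * (sqrt 2 * sin (real k * pi * x))) = (\<lambda>x. sqrt 2 * (f x * sin (real k * pi * x)))"
        by (simp add: fun_eq_iff)
      finally show ?thesis by simp
    qed (use not_less_eq_eq in auto)
  qed
  then show ?thesis
    unfolding u zero_L2_def by (subst ae_eq_iff) (auto simp: f sq_int_zero)
qed

lemma norm_sum_ebasis:
  assumes "finite I"
  shows "(norm (\<Sum>i\<in>I. c i *\<^sub>R ebasis (Suc i)))\<^sup>2 = (\<Sum>i\<in>I. (c i)\<^sup>2)"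
  using assms
  by (subst norm_sum_Pythagorean)
     (auto simp: pairwise_def orthogonal_def ebasis_orthonormal ebasis_norm power_mult_distrib power2_norm_eq_inner)

lemma summable_orthogonal:
  fixes b :: "nat \<Rightarrow> L2"
  assumes orth: "\<And>i j. i \<noteq> j \<Longrightarrow> b i \<bullet> b j = 0" and sum: "summable (\<lambda>i. (norm (b i))\<^sup>2)"
  shows "summable b"
  unfolding summable_Cauchy
proof (intro allI impI)
  fix \<epsilon> :: real assume "\<epsilon> > 0"
  then have "\<epsilon>\<^sup>2 > 0" by simp
  then obtain N where N: "\<And>m n. m \<ge> N \<Longrightarrow> norm (\<Sum>i\<in>{m..<n}. (norm (b i))\<^sup>2) < \<epsilon>\<^sup>2"
    using sum unfolding summable_Cauchy by blast
  have "norm (sum b {m..<n}) < \<epsilon>" if "m \<ge> N" for m n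
  proof (rule power2_less_imp_less)
    have "(norm (sum b {m..<n}))\<^sup>2 = (\<Sum>i\<in>{m..<n}. (norm (b i))\<^sup>2)"
      by (rule norm_sum_Pythagorean) (auto simp: pairwise_def orthogonal_def orth)
    then show "(norm (sum b {m..<n}))\<^sup>2 < \<epsilon>\<^sup>2"
      using N[OF that, of n] by (simp add: abs_of_nonneg sum_nonneg)
  qed (use \<open>\<epsilon> > 0\<close> in simp)
  then show "\<exists>N. \<forall>m\<ge>N. \<forall>n. norm (sum b {m..<n}) < \<epsilon>" by blast
qed

lemma summable_ebasis:
  assumes "summable (\<lambda>i. (c i)\<^sup>2)"
  shows "summable (\<lambda>i. c i *\<^sub>R ebasis (Suc i))"
proof (rule summable_orthogonal)
  have "(norm (c i *\<^sub>R ebasis (Suc i)))\<^sup>2 = (c i)\<^sup>2" for i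
    by (simp add: power_mult_distrib power2_norm_eq_inner ebasis_norm)
  then show "summable (\<lambda>i. (norm (c i *\<^sub>R ebasis (Suc i)))\<^sup>2)"
    using assms by simp
qed (simp add: ebasis_orthonormal)

lemma inner_suminf_ebasis:
  assumes "summable (\<lambda>i. (c i)\<^sup>2)"
  shows "(\<Sum>i. c i *\<^sub>R ebasis (Suc i)) \<bullet> ebasis (Suc j) = c j"
proof -
  have "(\<lambda>i. (c i *\<^sub>R ebasis (Suc i)) \<bullet> ebasis (Suc j)) sums
      ((\<Sum>i. c i *\<^sub>R ebasis (Suc i)) \<bullet> ebasis (Suc j))"
    by (rule bounded_linear.sums[OF bounded_linear_inner_left summable_sums[OF summable_ebasis[OF assms]]])
  moreover have "(\<lambda>i. (c i *\<^sub>R ebasis (Suc i)) \<bullet> ebasis (Suc j)) = (\<lambda>i. if i = j then c i else 0)"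
    by (auto simp: ebasis_orthonormal fun_eq_iff)
  ultimately show ?thesis
    using sums_single[of j c] sums_unique2 by fastforce
qed

lemma bessel_ebasis: "summable (\<lambda>i. (u \<bullet> ebasis (Suc i))\<^sup>2)"
proof (rule summableI_nonneg_bounded)
  fix n
  let ?p = "\<Sum>i<n. (u \<bullet> ebasis (Suc i)) *\<^sub>R ebasis (Suc i)"
  have "u \<bullet> ?p = (\<Sum>i<n. (u \<bullet> ebasis (Suc i))\<^sup>2)"
    by (simp add: inner_sum_right power2_eq_square)
  moreover have "0 \<le> (norm (u - ?p))\<^sup>2" by simp
  moreover have "(norm (u - ?p))\<^sup>2 = (norm u)\<^sup>2 - 2 * (u \<bullet> ?p) + (norm ?p)\<^sup>2"
    by (simp add: power2_norm_eq_inner inner_diff inner_commute)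
  ultimately show "(\<Sum>i<n. (u \<bullet> ebasis (Suc i))\<^sup>2) \<le> (norm u)\<^sup>2"
    by (simp add: norm_sum_ebasis)
qed simp

lemma ebasis_expansion: "(\<lambda>i. (u \<bullet> ebasis (Suc i)) *\<^sub>R ebasis (Suc i)) sums u"
proof -
  let ?s = "\<Sum>i. (u \<bullet> ebasis (Suc i)) *\<^sub>R ebasis (Suc i)"
  have "u - ?s = 0"
  proof (rule ebasis_complete)
    fix i :: nat assume "i \<ge> 1"
    then obtain j where "i = Suc j" by (cases i) auto
    then show "(u - ?s) \<bullet> ebasis i = 0"
      using inner_suminf_ebasis[OF bessel_ebasis, of u j] by (simp add: inner_diff_left)
  qed
  then show ?thesis
    using summable_sums[OF summable_ebasis[OF bessel_ebasis, of u]] by simp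
qed

lemma norm_ebasis_le: "norm (ebasis (Suc i)) \<le> 1"
  using ebasis_norm[of "Suc i"] by (simp add: norm_eq_sqrt_inner)

instance L2 :: second_countable_topology
proof
  define d where "d qs = (\<Sum>i<length qs. of_rat (qs ! i) *\<^sub>R ebasis (Suc i))" for qs :: "rat list"
  have dense: "\<exists>qs. dist (d qs) u < \<epsilon>" if "\<epsilon> > 0" for u \<epsilon>
  proof -
    let ?c = "\<lambda>i. u \<bullet> ebasis (Suc i)"
    have "(\<lambda>n. \<Sum>i<n. ?c i *\<^sub>R ebasis (Suc i)) \<longlonglongrightarrow> u"
      using ebasis_expansion[of u] by (simp add: sums_def)
    then obtain n where n: "dist (\<Sum>i<n. ?c i *\<^sub>R ebasis (Suc i)) u < \<epsilon> / 2"
      using metric_LIMSEQ_D[of _ _ "\<epsilon> / 2"] \<open>\<epsilon> > 0\<close> half_gt_zero by blast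
    define \<delta> where "\<delta> = \<epsilon> / (2 * (real n + 1))"
    have "\<delta> > 0" using \<open>\<epsilon> > 0\<close> by (simp add: \<delta>_def)
    have "\<exists>q. \<bar>of_rat q - ?c i\<bar> < \<delta>" for i
    proof -
      obtain q where "?c i - \<delta> < of_rat q" "of_rat q < ?c i + \<delta>"
        using of_rat_dense[of "?c i - \<delta>" "?c i + \<delta>"] \<open>\<delta> > 0\<close> by auto
      then show ?thesis by (intro exI[of _ q]) (simp add: abs_less_iff)
    qed
    then obtain q where q: "\<And>i. \<bar>of_rat (q i) - ?c i\<bar> < \<delta>" by metis
    let ?qs = "map q [0..<n]"
    have "d ?qs - (\<Sum>i<n. ?c i *\<^sub>R ebasis (Suc i)) = (\<Sum>i<n. (of_rat (q i) - ?c i) *\<^sub>R ebasis (Suc i))"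
      by (simp add: d_def scaleR_left_diff_distrib sum_subtractf)
    also have "norm \<dots> \<le> (\<Sum>i<n. \<delta>)"
    proof (rule sum_norm_le)
      fix i
      have "\<bar>of_rat (q i) - ?c i\<bar> * norm (ebasis (Suc i)) \<le> \<delta> * 1"
        using q[of i] \<open>\<delta> > 0\<close> by (intro mult_mono norm_ebasis_le) auto
      then show "norm ((of_rat (q i) - ?c i) *\<^sub>R ebasis (Suc i)) \<le> \<delta>" by simp
    qed
    also have "\<dots> \<le> \<epsilon> / 2"
      using \<open>\<epsilon> > 0\<close> by (simp add: \<delta>_def field_simps)
    finally have "dist (d ?qs) (\<Sum>i<n. ?c i *\<^sub>R ebasis (Suc i)) \<le> \<epsilon> / 2"
      by (simp add: dist_norm)
    then have "dist (d ?qs) u < \<epsilon>"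
      using n dist_triangle[of "d ?qs" u "\<Sum>i<n. ?c i *\<^sub>R ebasis (Suc i)"] by linarith
    then show ?thesis by blast
  qed
  define B where "B = (\<lambda>(qs, k::nat). ball (d qs) (inverse (real (Suc k)))) ` UNIV"
  have "topological_basis B"
  proof (rule topological_basisI)
    fix O' and u :: L2 assume "open O'" "u \<in> O'"
    then obtain \<epsilon> where \<epsilon>: "\<epsilon> > 0" "ball u \<epsilon> \<subseteq> O'"
      unfolding open_contains_ball by blast
    obtain k where k: "inverse (real (Suc k)) < \<epsilon> / 2"
      using reals_Archimedean[of "\<epsilon> / 2"] \<epsilon> by auto
    obtain qs where qs: "dist (d qs) u < inverse (real (Suc k))"
      using dense[of "inverse (real (Suc k))" u] by auto
    have "ball (d qs) (inverse (real (Suc k))) \<subseteq> ball u \<epsilon>"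
    proof
      fix v assume "v \<in> ball (d qs) (inverse (real (Suc k)))"
      then show "v \<in> ball u \<epsilon>"
        using qs k dist_triangle[of u v "d qs"] by (simp add: dist_commute)
    qed
    then show "\<exists>B'\<in>B. u \<in> B' \<and> B' \<subseteq> O'"
      using qs \<epsilon>(2) unfolding B_def by (intro bexI[of _ "ball (d qs) (inverse (real (Suc k)))"]) auto
  qed (auto simp: B_def)
  moreover have "countable B"
    unfolding B_def by (intro countable_image) auto
  ultimately show "\<exists>B::L2 set set. countable B \<and> open = generate_topology B"
    using topological_basis_imp_subbasis by blast
qed

subsection \<open>The Dirichlet Laplacian\<close>

text \<open>The test functions are \<open>C\<^sup>1\<^sub>c(0,1)\<close>, extended by zero to the real line; they give the same weak
  derivatives and the same closure in \<open>H\<^sup>1\<close> as \<open>C\<^sup>\<infinity>\<^sub>c(0,1)\<close>.\<close>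

definition test_fun :: "(real \<Rightarrow> real) \<Rightarrow> bool" where
  "test_fun \<phi> \<longleftrightarrow> (\<forall>x. \<phi> differentiable (at x)) \<and> continuous_on UNIV (deriv \<phi>)
     \<and> (\<exists>a b. 0 < a \<and> b < 1 \<and> (\<forall>x. x \<notin> {a..b} \<longrightarrow> \<phi> x = 0))"

definition weak_deriv :: "L2 \<Rightarrow> L2 \<Rightarrow> bool" where
  "weak_deriv u g \<longleftrightarrow> (\<forall>\<phi>. test_fun \<phi> \<longrightarrow> u \<bullet> abs_L2 (deriv \<phi>) = - (g \<bullet> abs_L2 \<phi>))"

text \<open>\<open>H\<^sup>1\<^sub>0\<close> is the closure of the test functions in the \<open>H\<^sup>1\<close> norm, that is, the closure of the graph
  of the derivative in \<open>L\<^sup>2 \<times> L\<^sup>2\<close>, projected to the first component.\<close>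

definition H10 :: "L2 set" where
  "H10 = fst ` closure {(abs_L2 \<phi>, abs_L2 (deriv \<phi>)) |\<phi>. test_fun \<phi>}"

definition H2 :: "L2 set" where
  "H2 = {u. \<exists>g h. weak_deriv u g \<and> weak_deriv g h}"

definition dom_lap :: "L2 set" where
  "dom_lap = H10 \<inter> H2"

text \<open>Weak derivatives are unique (lemma \<open>weak_deriv_unique\<close>), so the description operator is well
  defined on \<open>dom_lap\<close>.\<close>

definition lap :: "L2 \<Rightarrow> L2" where
  "lap u = (THE h. \<exists>g. weak_deriv u g \<and> weak_deriv g h)"


lemma test_fun_deriv:
  assumes "test_fun \<phi>" shows "(\<phi> has_real_derivative deriv \<phi> x) (at x)"
  using assms by (simp add: test_fun_def DERIV_deriv_iff_real_differentiable)

lemma test_fun_cont: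
  assumes "test_fun \<phi>" shows "continuous_on A \<phi>" "continuous_on A (deriv \<phi>)"
  using assms test_fun_deriv[OF assms]
  by (auto simp: test_fun_def intro: DERIV_isCont continuous_at_imp_continuous_on continuous_on_subset)

lemma test_fun_sq_int:
  assumes "test_fun \<phi>" shows "sq_int \<phi>" "sq_int (deriv \<phi>)"
  using test_fun_cont[OF assms] by (auto intro: sq_int_continuous)

lemma test_fun_ends:
  assumes "test_fun \<phi>" shows "\<phi> 0 = 0" "\<phi> 1 = 0"
  using assms unfolding test_fun_def by force+

lemma weak_deriv_classical:
  assumes f: "\<And>x. (f has_real_derivative f' x) (at x)" and c: "continuous_on {0..1} f'"
  shows "weak_deriv (abs_L2 f) (abs_L2 f')"
  unfolding weak_deriv_def
proof (intro allI impI)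
  fix \<phi> assume t: "test_fun \<phi>"
  have "continuous_on {0..1} f"
    using f by (auto intro!: DERIV_isCont continuous_at_imp_continuous_on)
  then have s: "sq_int f" "sq_int f'" using c by (auto intro: sq_int_continuous)
  have "(LINT x|M01. f' x * \<phi> x) = - (LINT x|M01. f x * deriv \<phi> x)"
    using LINT_by_parts[OF f test_fun_deriv[OF t] c test_fun_cont(2)[OF t]]
    by (simp add: test_fun_ends[OF t])
  then show "abs_L2 f \<bullet> abs_L2 (deriv \<phi>) = - (abs_L2 f' \<bullet> abs_L2 \<phi>)"
    by (simp add: inner_abs_L2 s test_fun_sq_int[OF t])
qed

lemma weak_deriv_lim:
  assumes "\<And>n. weak_deriv (u n) (g n)" "u \<longlonglongrightarrow> u'" "g \<longlonglongrightarrow> g'"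
  shows "weak_deriv u' g'"
  unfolding weak_deriv_def
proof (intro allI impI)
  fix \<phi> assume "test_fun \<phi>"
  then have "u n \<bullet> abs_L2 (deriv \<phi>) = - (g n \<bullet> abs_L2 \<phi>)" for n
    using assms(1) by (simp add: weak_deriv_def)
  moreover have "(\<lambda>n. u n \<bullet> abs_L2 (deriv \<phi>)) \<longlonglongrightarrow> u' \<bullet> abs_L2 (deriv \<phi>)"
    by (intro tendsto_intros assms)
  moreover have "(\<lambda>n. - (g n \<bullet> abs_L2 \<phi>)) \<longlonglongrightarrow> - (g' \<bullet> abs_L2 \<phi>)"
    by (intro tendsto_intros assms)
  ultimately show "u' \<bullet> abs_L2 (deriv \<phi>) = - (g' \<bullet> abs_L2 \<phi>)"
    using LIMSEQ_unique by simp
qed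

lemma weak_deriv_0: "weak_deriv 0 0"
  by (simp add: weak_deriv_def)

lemma weak_deriv_add: "weak_deriv u g \<Longrightarrow> weak_deriv v h \<Longrightarrow> weak_deriv (u + v) (g + h)"
  by (simp add: weak_deriv_def inner_add_left)

lemma weak_deriv_scale: "weak_deriv u g \<Longrightarrow> weak_deriv (c *\<^sub>R u) (c *\<^sub>R g)"
  by (simp add: weak_deriv_def)

lemma weak_deriv_sum:
  "(\<And>i. i \<in> I \<Longrightarrow> weak_deriv (u i) (g i)) \<Longrightarrow> weak_deriv (\<Sum>i\<in>I. u i) (\<Sum>i\<in>I. g i)"
  by (induction I rule: infinite_finite_induct) (auto intro: weak_deriv_0 weak_deriv_add)

lemma weak_deriv_ebasis: "weak_deriv (ebasis i) (dbasis i)"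
  unfolding ebasis_def dbasis_def
  by (rule weak_deriv_classical) (auto intro!: derivative_eq_intros continuous_intros)

lemma weak_deriv_dbasis: "weak_deriv (dbasis i) (- eigval i *\<^sub>R ebasis i)"
proof -
  have "- eigval i *\<^sub>R ebasis i = abs_L2 (\<lambda>x. - eigval i * (sqrt 2 * sin (real i * pi * x)))"
    unfolding ebasis_def by (rule scaleR_abs_L2[OF sq_int_ebasis])
  then show ?thesis
    unfolding dbasis_def
    by (simp only:)
       (rule weak_deriv_classical,
        auto intro!: derivative_eq_intros continuous_intros simp: eigval_def power2_eq_square)
qed

lemma tendsto_abs_L2:
  assumes f: "\<And>n. sq_int (f n)" and g: "sq_int g"
    and lim: "\<And>x. 0 < x \<Longrightarrow> x < 1 \<Longrightarrow> (\<lambda>n. f n x) \<longlonglongrightarrow> g x"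
    and bd: "\<And>n x. 0 < x \<Longrightarrow> x < 1 \<Longrightarrow> \<bar>f n x - g x\<bar> \<le> B"
  shows "(\<lambda>n. abs_L2 (f n)) \<longlonglongrightarrow> abs_L2 g"
proof -
  have "(\<lambda>n. LINT x|M01. (f n x - g x)\<^sup>2) \<longlonglongrightarrow> (LINT x|M01. 0)"
  proof (rule integral_dominated_convergence)
    show "integrable M01 (\<lambda>x. B\<^sup>2)"
      using sq_int_integrable[OF sq_int_const] .
    show "(\<lambda>x. (f n x - g x)\<^sup>2) \<in> borel_measurable M01" for n
      using f g unfolding sq_int_def by (intro borel_measurable_power borel_measurable_diff) auto
    show "AE x in M01. (\<lambda>n. (f n x - g x)\<^sup>2) \<longlonglongrightarrow> 0"
    proof (rule AE_I2)
      fix x assume "x \<in> space M01"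
      then have "(\<lambda>n. f n x - g x) \<longlonglongrightarrow> 0" using lim[of x] by (simp add: LIM_zero)
      from tendsto_power[OF this, of 2] show "(\<lambda>n. (f n x - g x)\<^sup>2) \<longlonglongrightarrow> 0" by simp
    qed
    show "AE x in M01. norm ((f n x - g x)\<^sup>2) \<le> B\<^sup>2" for n
    proof (rule AE_I2)
      fix x assume "x \<in> space M01"
      then have "\<bar>f n x - g x\<bar>\<^sup>2 \<le> B\<^sup>2" using bd[of x n] by (intro power_mono) auto
      then show "norm ((f n x - g x)\<^sup>2) \<le> B\<^sup>2" by simp
    qed
  qed simp
  then have "(\<lambda>n. sqrt (LINT x|M01. (f n x - g x)\<^sup>2)) \<longlonglongrightarrow> sqrt 0"
    by (intro tendsto_real_sqrt) simp
  then have "(\<lambda>n. norm (abs_L2 (f n) - abs_L2 g)) \<longlonglongrightarrow> 0"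
    by (simp add: diff_abs_L2 f g norm_abs_L2 sq_int_diff)
  then show ?thesis
    by (rule LIM_zero_cancel[OF tendsto_norm_zero_cancel])
qed

lemma DERIV_pos_square: "((\<lambda>y. (max 0 y)\<^sup>2) has_real_derivative 2 * max 0 y) (at (y::real))"
proof -
  consider "y > 0" | "y < 0" | "y = 0" by linarith
  then show ?thesis
  proof cases
    case 1
    have "((\<lambda>y. y\<^sup>2) has_real_derivative 2 * max 0 y) (at y)"
      using 1 by (auto intro!: derivative_eq_intros)
    then show ?thesis
    proof (rule has_field_derivative_transform_within_open[of _ _ _ "{0<..}"])
    qed (use 1 in auto)
  next
    case 2
    have "((\<lambda>y. 0) has_real_derivative 2 * max 0 y) (at y)"
      using 2 by (auto intro!: derivative_eq_intros)
    then show ?thesis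
    proof (rule has_field_derivative_transform_within_open[of _ _ _ "{..<0}"])
    qed (use 2 in auto)
  next
    case 3
    have "((\<lambda>h. (max 0 (0 + h))\<^sup>2 / h) \<longlongrightarrow> 0) (at (0::real))"
    proof (rule Lim_null_comparison)
      show "\<forall>\<^sub>F h in at (0::real). norm ((max 0 (0 + h))\<^sup>2 / h) \<le> \<bar>h\<bar>"
        by (auto simp: max_def power2_eq_square intro!: always_eventually)
      show "((\<lambda>h::real. \<bar>h\<bar>) \<longlongrightarrow> 0) (at 0)"
        by (rule tendsto_rabs_zero) (rule tendsto_ident_at)
    qed
    then show ?thesis
      using 3 by (simp add: DERIV_def)
  qed
qed

lemma cutoff_bounds:
  fixes d w :: real
  assumes "d > 0" "w > 0"
  defines "m \<equiv> max 0 (w - d)"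
  shows "2 * m * d\<^sup>2 / (m\<^sup>2 + d\<^sup>2)\<^sup>2 * w \<le> 4"
    and "0 \<le> 2 * m * d\<^sup>2 / (m\<^sup>2 + d\<^sup>2)\<^sup>2"
    and "0 \<le> m\<^sup>2 / (m\<^sup>2 + d\<^sup>2)" "m\<^sup>2 / (m\<^sup>2 + d\<^sup>2) \<le> 1"
proof -
  have m: "m \<ge> 0" "w \<le> m + d" by (auto simp: m_def)
  define s where "s = m\<^sup>2 + d\<^sup>2"
  have d2: "d\<^sup>2 > 0" using assms by simp
  then have s: "s > 0" "d\<^sup>2 \<le> s" "m\<^sup>2 \<le> s"
    unfolding s_def by (auto simp: add_nonneg_pos)
  have "2 * m * d\<^sup>2 * w \<le> 2 * m * d\<^sup>2 * (m + d)"
    using m by (intro mult_left_mono) auto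
  also have "\<dots> = d\<^sup>2 * (2 * m\<^sup>2 + 2 * m * d)" by (simp add: power2_eq_square algebra_simps)
  also have "\<dots> \<le> d\<^sup>2 * (4 * s)"
  proof (rule mult_left_mono)
    have "0 \<le> (m - d)\<^sup>2" by simp
    then show "2 * m\<^sup>2 + 2 * m * d \<le> 4 * s"
      unfolding power2_diff s_def using d2 by (smt (verit) zero_le_power2)
  qed simp
  also have "\<dots> \<le> s * (4 * s)" using s by (intro mult_right_mono) auto
  finally have "2 * m * d\<^sup>2 * w \<le> 4 * s\<^sup>2" by (simp add: power2_eq_square)
  then show "2 * m * d\<^sup>2 / (m\<^sup>2 + d\<^sup>2)\<^sup>2 * w \<le> 4"
    unfolding s_def[symmetric] using s by (simp add: pos_divide_le_eq)
  show "0 \<le> 2 * m * d\<^sup>2 / (m\<^sup>2 + d\<^sup>2)\<^sup>2" "0 \<le> m\<^sup>2 / (m\<^sup>2 + d\<^sup>2)" "m\<^sup>2 / (m\<^sup>2 + d\<^sup>2) \<le> 1"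
    using m s by (simp_all add: s_def)
qed

lemma sin_bound_01:
  assumes "0 < x" "x < 1"
  shows "\<bar>sin (real i * pi * x)\<bar> \<le> 2 * (real i * pi) * (x * (1 - x))"
proof -
  have "\<bar>sin (real i * pi * x)\<bar> \<le> \<bar>real i * pi * x\<bar>" by (rule abs_sin_x_le_abs_x)
  then have 1: "\<bar>sin (real i * pi * x)\<bar> \<le> (real i * pi) * x" using assms by (simp add: abs_mult)
  have "sin (real i * pi * (1 - x)) = sin (real i * pi - real i * pi * x)" by (simp add: algebra_simps)
  also have "\<dots> = - cos (real i * pi) * sin (real i * pi * x)" by (simp add: sin_diff)
  finally have "\<bar>sin (real i * pi * (1 - x))\<bar> = \<bar>sin (real i * pi * x)\<bar>"
    by (simp add: abs_mult cos_npi)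
  moreover have "\<bar>sin (real i * pi * (1 - x))\<bar> \<le> \<bar>real i * pi * (1 - x)\<bar>" by (rule abs_sin_x_le_abs_x)
  ultimately have 2: "\<bar>sin (real i * pi * x)\<bar> \<le> (real i * pi) * (1 - x)" using assms by (simp add: abs_mult)
  show ?thesis
  proof (cases "x \<le> 1/2")
    case True
    then have "x * 1 \<le> x * (2 * (1 - x))" using assms by (intro mult_left_mono) auto
    then have "(real i * pi) * x \<le> (real i * pi) * (x * (2 * (1 - x)))" by (intro mult_left_mono) auto
    also have "\<dots> = 2 * (real i * pi) * (x * (1 - x))" by simp
    finally show ?thesis using 1 by linarith
  next
    case False
    then have "(1 - x) * 1 \<le> (1 - x) * (2 * x)" using assms by (intro mult_left_mono) auto
    then have "(real i * pi) * (1 - x) \<le> (real i * pi) * ((1 - x) * (2 * x))" by (intro mult_left_mono) auto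
    also have "\<dots> = 2 * (real i * pi) * (x * (1 - x))" by simp
    finally show ?thesis using 2 by linarith
  qed
qed

lemma ebasis_test_approx:
  obtains \<phi> where "\<And>n. test_fun (\<phi> n)" "(\<lambda>n. abs_L2 (\<phi> n)) \<longlonglongrightarrow> ebasis i"
    "(\<lambda>n. abs_L2 (deriv (\<phi> n))) \<longlonglongrightarrow> dbasis i"
proof -
  define d where "d n = inverse (real (Suc n))" for n
  have d: "d n > 0" for n by (simp add: d_def)
  have d0: "d \<longlonglongrightarrow> 0" unfolding d_def by (rule LIMSEQ_inverse_real_of_nat)
  define w where "w x = x * (1 - x)" for x :: real
  have w: "0 < x \<Longrightarrow> x < 1 \<Longrightarrow> w x > 0" for x by (simp add: w_def)
  define m where "m n x = max 0 (w x - d n)" for n x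
  define k where "k n x = (m n x)\<^sup>2 / ((m n x)\<^sup>2 + (d n)\<^sup>2)" for n x
  define k' where "k' n x = 2 * m n x * (d n)\<^sup>2 / ((m n x)\<^sup>2 + (d n)\<^sup>2)\<^sup>2" for n x
  define e where "e x = sqrt 2 * sin (real i * pi * x)" for x
  define e' where "e' x = sqrt 2 * (real i * pi) * cos (real i * pi * x)" for x
  define C where "C = 2 * sqrt 2 * (real i * pi)"
  have C: "C \<ge> 0" by (simp add: C_def)
  have den: "(m n x)\<^sup>2 + (d n)\<^sup>2 > 0" for n x using d[of n] by (simp add: add_nonneg_pos)
  have eb: "\<bar>e x\<bar> \<le> C * w x" if "0 < x" "x < 1" for x
    using mult_left_mono[OF sin_bound_01[OF that, of i], of "sqrt 2"]
    by (simp add: e_def C_def w_def abs_mult mult_ac)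
  have e'b: "\<bar>e' x\<bar> \<le> C" for x
  proof -
    have "(sqrt 2 * (real i * pi)) * \<bar>cos (real i * pi * x)\<bar> \<le> (sqrt 2 * (real i * pi)) * 1"
      by (intro mult_left_mono) auto
    also have "\<dots> \<le> C" by (simp add: C_def)
    finally show ?thesis by (simp add: e'_def abs_mult)
  qed
  define \<phi> where "\<phi> n x = k n x * e x" for n x
  define \<psi> where "\<psi> n x = k' n x * (1 - 2 * x) * e x + k n x * e' x" for n x
  have dm: "((\<lambda>x. (m n x)\<^sup>2) has_real_derivative 2 * m n x * (1 - 2 * x)) (at x)" for n x
    unfolding m_def
    by (rule DERIV_chain2[of "\<lambda>y. (max 0 y)\<^sup>2", OF DERIV_pos_square])
       (auto simp: w_def intro!: derivative_eq_intros)
  have dk: "(k n has_real_derivative k' n x * (1 - 2 * x)) (at x)" for n x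
  proof -
    have "((\<lambda>x. (m n x)\<^sup>2 / ((m n x)\<^sup>2 + (d n)\<^sup>2)) has_real_derivative
       ((2 * m n x * (1 - 2 * x)) * ((m n x)\<^sup>2 + (d n)\<^sup>2) - (m n x)\<^sup>2 * (2 * m n x * (1 - 2 * x)))
          / (((m n x)\<^sup>2 + (d n)\<^sup>2) * ((m n x)\<^sup>2 + (d n)\<^sup>2))) (at x)"
      using den[of n x] by (intro DERIV_divide dm DERIV_cong[OF DERIV_add[OF dm DERIV_const]]) auto
    moreover have "((2 * m n x * (1 - 2 * x)) * ((m n x)\<^sup>2 + (d n)\<^sup>2) - (m n x)\<^sup>2 * (2 * m n x * (1 - 2 * x)))
          = 2 * m n x * (d n)\<^sup>2 * (1 - 2 * x)"
      by (simp add: algebra_simps)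
    ultimately show ?thesis
      unfolding k'_def k_def[abs_def] by (simp add: power2_eq_square)
  qed
  have de: "(e has_real_derivative e' x) (at x)" for x
    unfolding e_def e'_def by (auto intro!: derivative_eq_intros)
  have d\<phi>: "(\<phi> n has_real_derivative \<psi> n x) (at x)" for n x
    unfolding \<phi>_def[abs_def] \<psi>_def
    by (rule DERIV_cong[OF DERIV_mult[OF dk de]]) simp
  then have deriv\<phi>: "deriv (\<phi> n) = \<psi> n" for n
    by (auto intro: DERIV_imp_deriv)
  have cm: "continuous_on A (m n)" for n A
    unfolding m_def w_def by (intro continuous_intros)
  have c\<psi>: "continuous_on A (\<psi> n)" for n A
    unfolding \<psi>_def k'_def k_def e_def e'_def
    using den[of n] by (intro continuous_intros cm) (auto simp: less_imp_neq[symmetric])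
  have test: "test_fun (\<phi> n)" for n
    unfolding test_fun_def deriv\<phi>
  proof (intro conjI allI, goal_cases)
    case (1 x)
    show ?case using d\<phi>[of n x] real_differentiable_def by blast
  next
    case 2
    show ?case by (rule c\<psi>)
  next
    case 3
    have out: "\<phi> n x = 0" if x: "x \<notin> {d n..1 - d n}" for x
    proof -
    have "w x \<le> d n"
    proof (rule ccontr)
      assume "\<not> w x \<le> d n"
      then have wx: "x * (1 - x) > d n" by (simp add: w_def)
      then have "x * (1 - x) > 0" using d[of n] by linarith
      then have "0 < x \<and> x < 1"
        by (auto simp: zero_less_mult_iff)
      then have "x * (1 - x) \<le> x" "x * (1 - x) \<le> 1 - x"
        by (auto simp: mult_left_le mult_left_le_one_le)
      with wx x show False by auto
    qed
      then show ?thesis by (simp add: \<phi>_def k_def m_def)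
    qed
    show ?case
      by (rule exI[of _ "d n"], rule exI[of _ "1 - d n"]) (use d[of n] out in auto)
  qed
  have mlim: "(\<lambda>n. m n x) \<longlonglongrightarrow> w x" if "0 < x" "x < 1" for x
  proof -
    have "(\<lambda>n. m n x) \<longlonglongrightarrow> max 0 (w x - 0)"
      unfolding m_def by (intro tendsto_intros d0)
    then show ?thesis using w[OF that] by simp
  qed
  have klim: "(\<lambda>n. k n x) \<longlonglongrightarrow> 1" if "0 < x" "x < 1" for x
  proof -
    have "(\<lambda>n. k n x) \<longlonglongrightarrow> (w x)\<^sup>2 / ((w x)\<^sup>2 + 0\<^sup>2)"
      unfolding k_def using w[OF that] by (intro tendsto_intros mlim d0 that) auto
    then show ?thesis using w[OF that] by simp
  qed
  have k'lim: "(\<lambda>n. k' n x) \<longlonglongrightarrow> 0" if "0 < x" "x < 1" for x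
  proof -
    have "(\<lambda>n. k' n x) \<longlonglongrightarrow> 2 * w x * 0\<^sup>2 / ((w x)\<^sup>2 + 0\<^sup>2)\<^sup>2"
      unfolding k'_def using w[OF that] by (intro tendsto_intros mlim d0 that) auto
    then show ?thesis by simp
  qed
  have kb: "0 \<le> k n x" "k n x \<le> 1" if "0 < x" "x < 1" for n x
    using cutoff_bounds(3,4)[OF d[of n] w[OF that]] by (auto simp: k_def m_def)
  have k'b: "\<bar>k' n x * (1 - 2 * x) * e x\<bar> \<le> 4 * C" if x: "0 < x" "x < 1" for n x
  proof -
    have k0: "0 \<le> k' n x" "k' n x * w x \<le> 4"
      using cutoff_bounds(1,2)[OF d[of n] w[OF that]] by (auto simp: k'_def m_def)
    have "\<bar>k' n x * (1 - 2 * x) * e x\<bar> = k' n x * (\<bar>1 - 2 * x\<bar> * \<bar>e x\<bar>)"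
      using k0 by (simp add: abs_mult)
    also have "\<dots> \<le> k' n x * (1 * (C * w x))"
      using x k0 eb[OF x] by (intro mult_left_mono mult_mono) auto
    also have "\<dots> = (k' n x * w x) * C" by simp
    also have "\<dots> \<le> 4 * C" using k0 C by (intro mult_right_mono) auto
    finally show ?thesis .
  qed
  have kd: "\<bar>k n x * y - y\<bar> \<le> \<bar>y\<bar>" if "0 < x" "x < 1" for n x y
  proof -
    have "\<bar>k n x * y - y\<bar> = \<bar>k n x - 1\<bar> * \<bar>y\<bar>"
      by (simp add: abs_mult[symmetric] left_diff_distrib)
    also have "\<dots> \<le> 1 * \<bar>y\<bar>" using kb[OF that, of n] by (intro mult_right_mono) auto
    finally show ?thesis by simp
  qed
  have se: "sq_int e" "sq_int e'"
    unfolding e_def[abs_def] e'_def[abs_def] by (rule sq_int_ebasis, rule sq_int_dbasis)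
  have 1: "(\<lambda>n. abs_L2 (\<phi> n)) \<longlonglongrightarrow> abs_L2 e"
  proof (rule tendsto_abs_L2[where B = "sqrt 2", OF test_fun_sq_int(1)[OF test] se(1)])
    fix x :: real assume x: "0 < x" "x < 1"
    have "(\<lambda>n. \<phi> n x) \<longlonglongrightarrow> 1 * e x" unfolding \<phi>_def by (intro tendsto_intros klim x)
    then show "(\<lambda>n. \<phi> n x) \<longlonglongrightarrow> e x" by simp
    fix n
    have "\<bar>e x\<bar> \<le> sqrt 2" by (simp add: e_def abs_mult)
    then show "\<bar>\<phi> n x - e x\<bar> \<le> sqrt 2"
      using kd[OF x, of n "e x"] by (simp add: \<phi>_def)
  qed
  have 2: "(\<lambda>n. abs_L2 (deriv (\<phi> n))) \<longlonglongrightarrow> abs_L2 e'"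
  proof (rule tendsto_abs_L2[where B = "5 * C", OF test_fun_sq_int(2)[OF test] se(2)])
    fix x :: real assume x: "0 < x" "x < 1"
    have "(\<lambda>n. \<psi> n x) \<longlonglongrightarrow> 0 * (1 - 2 * x) * e x + 1 * e' x"
      unfolding \<psi>_def by (intro tendsto_intros klim k'lim x)
    then show "(\<lambda>n. deriv (\<phi> n) x) \<longlonglongrightarrow> e' x" by (simp add: deriv\<phi>)
    fix n
    show "\<bar>deriv (\<phi> n) x - e' x\<bar> \<le> 5 * C"
      using kd[OF x, of n "e' x"] k'b[OF x, of n] e'b[of x] unfolding deriv\<phi> \<psi>_def by linarith
  qed
  show thesis
    using that[of \<phi>, OF test] 1 2 by (simp add: ebasis_def dbasis_def e_def[abs_def] e'_def[abs_def])
qed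

subsection \<open>Spectral description of the Dirichlet Laplacian\<close>

lemma weak_deriv_coeff:
  assumes "weak_deriv g h" shows "h \<bullet> ebasis i = - (g \<bullet> dbasis i)"
proof -
  obtain \<phi> where \<phi>: "\<And>n. test_fun (\<phi> n)" "(\<lambda>n. abs_L2 (\<phi> n)) \<longlonglongrightarrow> ebasis i"
    "(\<lambda>n. abs_L2 (deriv (\<phi> n))) \<longlonglongrightarrow> dbasis i"
    using ebasis_test_approx by blast
  have "(\<lambda>n. h \<bullet> abs_L2 (\<phi> n)) \<longlonglongrightarrow> h \<bullet> ebasis i"
    by (intro tendsto_intros \<phi>)
  moreover have "(\<lambda>n. h \<bullet> abs_L2 (\<phi> n)) = (\<lambda>n. - (g \<bullet> abs_L2 (deriv (\<phi> n))))"
    using assms \<phi>(1) by (simp add: weak_deriv_def)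
  moreover have "(\<lambda>n. - (g \<bullet> abs_L2 (deriv (\<phi> n)))) \<longlonglongrightarrow> - (g \<bullet> dbasis i)"
    by (intro tendsto_intros \<phi>)
  ultimately show ?thesis
    using LIMSEQ_unique by simp
qed

lemma weak_deriv_unique:
  assumes "weak_deriv u g" "weak_deriv u g'" shows "g = g'"
proof -
  have "(g - g') \<bullet> ebasis i = 0" for i
    using weak_deriv_coeff[OF assms(1), of i] weak_deriv_coeff[OF assms(2), of i]
    by (simp add: inner_diff_left)
  then have "g - g' = 0" by (intro ebasis_complete)
  then show ?thesis by simp
qed

abbreviation test_graph :: "(L2 \<times> L2) set" where
  "test_graph \<equiv> {(abs_L2 \<phi>, abs_L2 (deriv \<phi>)) |\<phi>. test_fun \<phi>}"

lemma test_graph_weak_deriv: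
  assumes "(u, g) \<in> test_graph" shows "weak_deriv u g"
proof -
  obtain \<phi> where "test_fun \<phi>" "u = abs_L2 \<phi>" "g = abs_L2 (deriv \<phi>)"
    using assms by auto
  then show ?thesis
    by (auto intro: weak_deriv_classical test_fun_deriv test_fun_cont)
qed

lemma H10_coeff:
  assumes "(u, g) \<in> closure test_graph"
  shows "weak_deriv u g" "g \<bullet> dbasis i = eigval i * (u \<bullet> ebasis i)"
proof -
  obtain x where x: "\<And>n. x n \<in> test_graph" "x \<longlonglongrightarrow> (u, g)"
    using assms unfolding closure_sequential by blast
  have f: "(\<lambda>n. fst (x n)) \<longlonglongrightarrow> u" and s: "(\<lambda>n. snd (x n)) \<longlonglongrightarrow> g"
    using tendsto_fst[OF x(2)] tendsto_snd[OF x(2)] by auto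
  have wd: "weak_deriv (fst (x n)) (snd (x n))" for n
    using x(1)[of n] by (intro test_graph_weak_deriv) simp
  show "weak_deriv u g"
    by (rule weak_deriv_lim[OF wd f s])
  have "snd (x n) \<bullet> dbasis i = eigval i * (fst (x n) \<bullet> ebasis i)" for n
  proof -
    obtain \<phi> where \<phi>: "test_fun \<phi>" "x n = (abs_L2 \<phi>, abs_L2 (deriv \<phi>))"
      using x(1)[of n] by auto
    then show ?thesis
      using weak_deriv_dbasis[of i] by (simp add: weak_deriv_def inner_commute)
  qed
  moreover have "(\<lambda>n. snd (x n) \<bullet> dbasis i) \<longlonglongrightarrow> g \<bullet> dbasis i"
    by (intro tendsto_intros s)
  moreover have "(\<lambda>n. eigval i * (fst (x n) \<bullet> ebasis i)) \<longlonglongrightarrow> eigval i * (u \<bullet> ebasis i)"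
    by (intro tendsto_intros f)
  ultimately show "g \<bullet> dbasis i = eigval i * (u \<bullet> ebasis i)"
    using LIMSEQ_unique by simp
qed

lemma closure_seqI:
  fixes l :: "'a::first_countable_topology"
  shows "(\<And>n. x n \<in> S) \<Longrightarrow> x \<longlonglongrightarrow> l \<Longrightarrow> l \<in> closure S"
  unfolding closure_sequential by blast

lemma test_fun_0: "test_fun (\<lambda>x. 0)"
  unfolding test_fun_def by (auto intro!: exI[of _ "1/2"])

lemma deriv_add_test:
  assumes "test_fun \<phi>" "test_fun \<psi>"
  shows "deriv (\<lambda>x. \<phi> x + \<psi> x) = (\<lambda>x. deriv \<phi> x + deriv \<psi> x)"
  by (intro ext DERIV_imp_deriv DERIV_add test_fun_deriv assms)

lemma deriv_scale_test:
  assumes "test_fun \<phi>"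
  shows "deriv (\<lambda>x. c * \<phi> x) = (\<lambda>x. c * deriv \<phi> x)"
  by (intro ext DERIV_imp_deriv DERIV_cmult test_fun_deriv assms)

lemma test_fun_add:
  assumes "test_fun \<phi>" "test_fun \<psi>" shows "test_fun (\<lambda>x. \<phi> x + \<psi> x)"
proof -
  obtain a b where ab: "0 < a" "b < 1" "\<And>x. x \<notin> {a..b} \<Longrightarrow> \<phi> x = 0"
    using assms(1) unfolding test_fun_def by blast
  obtain a' b' where ab': "0 < a'" "b' < 1" "\<And>x. x \<notin> {a'..b'} \<Longrightarrow> \<psi> x = 0"
    using assms(2) unfolding test_fun_def by blast
  have "\<exists>a b. 0 < a \<and> b < 1 \<and> (\<forall>x. x \<notin> {a..b} \<longrightarrow> \<phi> x + \<psi> x = 0)"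
  proof (rule exI[of _ "min a a'"], rule exI[of _ "max b b'"], intro conjI allI impI)
    fix x assume "x \<notin> {min a a'..max b b'}"
    then have "x \<notin> {a..b}" "x \<notin> {a'..b'}" by auto
    then show "\<phi> x + \<psi> x = 0" using ab(3) ab'(3) by simp
  qed (use ab ab' in auto)
  moreover have "continuous_on UNIV (\<lambda>x. deriv \<phi> x + deriv \<psi> x)"
    by (intro continuous_intros test_fun_cont assms)
  moreover have "(\<lambda>x. \<phi> x + \<psi> x) differentiable (at x)" for x
    using assms unfolding test_fun_def by (intro differentiable_add) auto
  ultimately show ?thesis
    unfolding test_fun_def deriv_add_test[OF assms] by blast
qed

lemma test_fun_scale:
  assumes "test_fun \<phi>" shows "test_fun (\<lambda>x. c * \<phi> x)"
proof -
  obtain a b where ab: "0 < a" "b < 1" "\<And>x. x \<notin> {a..b} \<Longrightarrow> \<phi> x = 0"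
    using assms(1) unfolding test_fun_def by blast
  have "\<exists>a b. 0 < a \<and> b < 1 \<and> (\<forall>x. x \<notin> {a..b} \<longrightarrow> c * \<phi> x = 0)"
    by (rule exI[of _ a], rule exI[of _ b]) (use ab in auto)
  moreover have "continuous_on UNIV (\<lambda>x. c * deriv \<phi> x)"
    by (intro continuous_intros test_fun_cont assms)
  moreover have "(\<lambda>x. c * \<phi> x) differentiable (at x)" for x
    using assms unfolding test_fun_def by (intro differentiable_mult) auto
  ultimately show ?thesis
    unfolding test_fun_def deriv_scale_test[OF assms] by blast
qed

lemma closure_test_graph_0: "0 \<in> closure test_graph"
proof -
  have "0 = (abs_L2 (\<lambda>x. 0), abs_L2 (deriv (\<lambda>x. 0)))"
    by (simp add: zero_L2_def zero_prod_def)
  then have "0 \<in> test_graph" using test_fun_0 by blast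
  then show ?thesis by (rule subsetD[OF closure_subset])
qed

lemma closure_test_graph_add:
  assumes "p \<in> closure test_graph" "q \<in> closure test_graph"
  shows "p + q \<in> closure test_graph"
proof -
  obtain x where x: "\<And>n. x n \<in> test_graph" "x \<longlonglongrightarrow> p"
    using assms(1) unfolding closure_sequential by blast
  obtain y where y: "\<And>n. y n \<in> test_graph" "y \<longlonglongrightarrow> q"
    using assms(2) unfolding closure_sequential by blast
  have "x n + y n \<in> test_graph" for n
  proof -
    obtain \<phi> where \<phi>: "test_fun \<phi>" "x n = (abs_L2 \<phi>, abs_L2 (deriv \<phi>))"
      using x(1)[of n] by auto
    obtain \<psi> where \<psi>: "test_fun \<psi>" "y n = (abs_L2 \<psi>, abs_L2 (deriv \<psi>))"
      using y(1)[of n] by auto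
    have "x n + y n = (abs_L2 (\<lambda>x. \<phi> x + \<psi> x), abs_L2 (deriv (\<lambda>x. \<phi> x + \<psi> x)))"
      using \<phi> \<psi> by (simp add: plus_abs_L2 test_fun_sq_int deriv_add_test)
    then show ?thesis using test_fun_add[OF \<phi>(1) \<psi>(1)] by blast
  qed
  moreover have "(\<lambda>n. x n + y n) \<longlonglongrightarrow> p + q" by (intro tendsto_intros x y)
  ultimately show ?thesis by (rule closure_seqI)
qed

lemma closure_test_graph_scale:
  assumes "p \<in> closure test_graph" shows "c *\<^sub>R p \<in> closure test_graph"
proof -
  obtain x where x: "\<And>n. x n \<in> test_graph" "x \<longlonglongrightarrow> p"
    using assms(1) unfolding closure_sequential by blast
  have "c *\<^sub>R x n \<in> test_graph" for n
  proof -
    obtain \<phi> where \<phi>: "test_fun \<phi>" "x n = (abs_L2 \<phi>, abs_L2 (deriv \<phi>))"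
      using x(1)[of n] by auto
    have "c *\<^sub>R x n = (abs_L2 (\<lambda>x. c * \<phi> x), abs_L2 (deriv (\<lambda>x. c * \<phi> x)))"
      using \<phi> by (simp add: scaleR_abs_L2 test_fun_sq_int deriv_scale_test)
    then show ?thesis using test_fun_scale[OF \<phi>(1)] by blast
  qed
  moreover have "(\<lambda>n. c *\<^sub>R x n) \<longlonglongrightarrow> c *\<^sub>R p" by (intro tendsto_intros x)
  ultimately show ?thesis by (rule closure_seqI)
qed

lemma closure_test_graph_ebasis: "(ebasis i, dbasis i) \<in> closure test_graph"
proof -
  obtain \<phi> where \<phi>: "\<And>n. test_fun (\<phi> n)" "(\<lambda>n. abs_L2 (\<phi> n)) \<longlonglongrightarrow> ebasis i"
    "(\<lambda>n. abs_L2 (deriv (\<phi> n))) \<longlonglongrightarrow> dbasis i"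
    using ebasis_test_approx by blast
  have "(abs_L2 (\<phi> n), abs_L2 (deriv (\<phi> n))) \<in> test_graph" for n
    using \<phi>(1) by blast
  moreover have "(\<lambda>n. (abs_L2 (\<phi> n), abs_L2 (deriv (\<phi> n)))) \<longlonglongrightarrow> (ebasis i, dbasis i)"
    using \<phi>(2,3) by (intro tendsto_Pair)
  ultimately show ?thesis by (rule closure_seqI)
qed

lemma lap_eqI:
  assumes "weak_deriv u g" "weak_deriv g h" shows "lap u = h"
  unfolding lap_def
  using assms by (intro the_equality) (auto dest: weak_deriv_unique)

lemma lap_coeff:
  assumes "u \<in> dom_lap" shows "lap u \<bullet> ebasis i = - eigval i * (u \<bullet> ebasis i)"
proof -
  obtain g h where gh: "weak_deriv u g" "weak_deriv g h"
    using assms by (auto simp: dom_lap_def H2_def)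
  obtain g' where "(u, g') \<in> closure test_graph"
    using assms by (auto simp: dom_lap_def H10_def)
  from H10_coeff[OF this] gh have "g \<bullet> dbasis i = eigval i * (u \<bullet> ebasis i)"
    using weak_deriv_unique by blast
  then show ?thesis
    using weak_deriv_coeff[OF gh(2), of i] by (simp add: lap_eqI[OF gh])
qed

text \<open>Functions of the (negative) Laplacian: the operator acting on the \<open>i\<close>-th eigenvector as
  multiplication by \<open>a i\<close>, on its maximal domain. Indices are shifted since the basis starts at \<open>1\<close>.\<close>

definition diag_dom :: "(nat \<Rightarrow> real) \<Rightarrow> L2 set" where
  "diag_dom a = {u. summable (\<lambda>i. (a (Suc i) * (u \<bullet> ebasis (Suc i)))\<^sup>2)}"

definition diag_op :: "(nat \<Rightarrow> real) \<Rightarrow> L2 \<Rightarrow> L2" where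
  "diag_op a u = (\<Sum>i. (a (Suc i) * (u \<bullet> ebasis (Suc i))) *\<^sub>R ebasis (Suc i))"

lemma eigval_ge_1: "eigval (Suc i) \<ge> 1"
proof -
  have "(1::real) \<le> pi" using pi_gt3 by simp
  then have "1 * 1 \<le> pi\<^sup>2 * (real (Suc i))\<^sup>2"
    by (intro mult_mono one_le_power) auto
  then show ?thesis by (simp add: eigval_def)
qed

lemma dom_lap_sufficient:
  assumes "u \<in> diag_dom eigval"
  shows "u \<in> dom_lap" "lap u = - diag_op eigval u"
proof -
  define c where "c i = u \<bullet> ebasis (Suc i)" for i
  have sm: "summable (\<lambda>i. (eigval (Suc i) * c i)\<^sup>2)"
    using assms by (simp add: diag_dom_def c_def)
  have us: "(\<lambda>i. c i *\<^sub>R ebasis (Suc i)) sums u"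
    unfolding c_def by (rule ebasis_expansion)
  have "summable (\<lambda>i. c i *\<^sub>R dbasis (Suc i))"
  proof (rule summable_orthogonal)
    show "(c i *\<^sub>R dbasis (Suc i)) \<bullet> (c j *\<^sub>R dbasis (Suc j)) = 0" if "i \<noteq> j" for i j
      using that by (simp add: dbasis_inner ebasis_orthonormal)
    have "(norm (c i *\<^sub>R dbasis (Suc i)))\<^sup>2 = eigval (Suc i) * (c i)\<^sup>2" for i
      by (simp add: power_mult_distrib power2_norm_eq_inner dbasis_inner ebasis_norm)
    moreover have "eigval (Suc i) * (c i)\<^sup>2 \<le> (eigval (Suc i) * c i)\<^sup>2" for i
    proof -
      have "eigval (Suc i) * 1 \<le> eigval (Suc i) * eigval (Suc i)"
        using eigval_ge_1[of i] by (intro mult_left_mono) auto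
      then show ?thesis
        unfolding power_mult_distrib power2_eq_square[of "eigval (Suc i)"]
        by (intro mult_right_mono) auto
    qed
    ultimately show "summable (\<lambda>i. (norm (c i *\<^sub>R dbasis (Suc i)))\<^sup>2)"
      using eigval_ge_1
      by (intro summable_comparison_test'[OF sm, of 0]) (simp add: order_trans[OF _ eigval_ge_1])
  qed
  then obtain g where gs: "(\<lambda>i. c i *\<^sub>R dbasis (Suc i)) sums g"
    by (auto simp: summable_def)
  have hs: "(\<lambda>i. (eigval (Suc i) * c i) *\<^sub>R ebasis (Suc i)) sums diag_op eigval u"
    unfolding diag_op_def c_def
    by (rule summable_sums[OF summable_ebasis]) (use sm in \<open>simp add: c_def\<close>)
  have "(\<Sum>i<n. c i *\<^sub>R ebasis (Suc i), \<Sum>i<n. c i *\<^sub>R dbasis (Suc i)) \<in> closure test_graph" for n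
  proof (induction n)
    case 0
    then show ?case using closure_test_graph_0 by (simp add: zero_prod_def)
  next
    case (Suc n)
    from closure_test_graph_add[OF Suc closure_test_graph_scale[OF closure_test_graph_ebasis, of "c n" "Suc n"]]
    show ?case by simp
  qed
  moreover have "(\<lambda>n. (\<Sum>i<n. c i *\<^sub>R ebasis (Suc i), \<Sum>i<n. c i *\<^sub>R dbasis (Suc i))) \<longlonglongrightarrow> (u, g)"
    using us gs unfolding sums_def by (intro tendsto_Pair)
  ultimately have "(u, g) \<in> closure test_graph"
    by (rule closed_sequentially[OF closed_closure])
  then have "u \<in> H10" unfolding H10_def by (metis (no_types, lifting) fst_conv imageI)
  have w1: "weak_deriv u g"
    using H10_coeff(1) \<open>(u, g) \<in> closure test_graph\<close> by blast
  have w2: "weak_deriv g (- diag_op eigval u)"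
  proof (rule weak_deriv_lim)
    show "weak_deriv (\<Sum>i<n. c i *\<^sub>R dbasis (Suc i)) (\<Sum>i<n. c i *\<^sub>R (- eigval (Suc i) *\<^sub>R ebasis (Suc i)))" for n
      by (intro weak_deriv_sum weak_deriv_scale weak_deriv_dbasis)
    show "(\<lambda>n. \<Sum>i<n. c i *\<^sub>R dbasis (Suc i)) \<longlonglongrightarrow> g"
      using gs by (simp add: sums_def)
    show "(\<lambda>n. \<Sum>i<n. c i *\<^sub>R (- eigval (Suc i) *\<^sub>R ebasis (Suc i))) \<longlonglongrightarrow> - diag_op eigval u"
      using tendsto_minus[OF hs[unfolded sums_def]] by (simp add: sum_negf mult.commute)
  qed
  show "u \<in> dom_lap"
    using \<open>u \<in> H10\<close> w1 w2 by (auto simp: dom_lap_def H2_def)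
  show "lap u = - diag_op eigval u"
    by (rule lap_eqI[OF w1 w2])
qed

lemma dom_lap_eq: "dom_lap = diag_dom eigval"
proof
  show "dom_lap \<subseteq> diag_dom eigval"
  proof
    fix u assume "u \<in> dom_lap"
    then show "u \<in> diag_dom eigval"
      using bessel_ebasis[of "lap u"] by (simp add: lap_coeff diag_dom_def)
  qed
qed (use dom_lap_sufficient in blast)

lemma lap_eq: "u \<in> dom_lap \<Longrightarrow> lap u = - diag_op eigval u"
  using dom_lap_sufficient dom_lap_eq by blast

lemma ebasis_eigenvector:
  assumes "i \<ge> 1" shows "ebasis i \<in> dom_lap" "- lap (ebasis i) = eigval i *\<^sub>R ebasis i"
proof -
  obtain j where j: "i = Suc j" using assms by (cases i) auto
  have w: "weak_deriv (ebasis i) (dbasis i)" "weak_deriv (dbasis i) (- eigval i *\<^sub>R ebasis i)"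
    by (rule weak_deriv_ebasis, rule weak_deriv_dbasis)
  have "ebasis i \<in> H10"
    unfolding H10_def using closure_test_graph_ebasis[of i] by (metis (no_types, lifting) fst_conv imageI)
  then show "ebasis i \<in> dom_lap" using w by (auto simp: dom_lap_def H2_def)
  show "- lap (ebasis i) = eigval i *\<^sub>R ebasis i"
    using lap_eqI[OF w] by simp
qed

subsection \<open>The heat semigroup\<close>

text \<open>The semigroup \<open>e\<^bsup>tA\<^esup>\<close>; lemmas \<open>heat_0\<close>, \<open>heat_add\<close>, \<open>heat_bounded_linear\<close>,
  \<open>heat_continuous\<close> and \<open>heat_generator\<close> show that it is the \<open>C\<^sub>0\<close>-semigroup generated by the Dirichlet
  Laplacian.\<close>

definition heat :: "real \<Rightarrow> L2 \<Rightarrow> L2" where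
  "heat t = diag_op (\<lambda>i. exp (- eigval i * t))"

lemma diag_op_sums:
  assumes "u \<in> diag_dom a"
  shows "(\<lambda>i. (a (Suc i) * (u \<bullet> ebasis (Suc i))) *\<^sub>R ebasis (Suc i)) sums diag_op a u"
  unfolding diag_op_def using assms
  by (intro summable_sums summable_ebasis) (simp add: diag_dom_def)

lemma diag_op_inner:
  assumes "u \<in> diag_dom a"
  shows "diag_op a u \<bullet> ebasis (Suc j) = a (Suc j) * (u \<bullet> ebasis (Suc j))"
  unfolding diag_op_def using assms
  by (intro inner_suminf_ebasis) (simp add: diag_dom_def)

lemma L2_eqI:
  assumes "\<And>i. u \<bullet> ebasis (Suc i) = v \<bullet> ebasis (Suc i)" shows "u = v"
proof -
  have "u - v = 0"
  proof (rule ebasis_complete)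
    fix i :: nat assume "i \<ge> 1"
    then obtain j where "i = Suc j" by (cases i) auto
    then show "(u - v) \<bullet> ebasis i = 0" using assms by (simp add: inner_diff_left)
  qed
  then show ?thesis by simp
qed

lemma norm_ebasis_suminf: "(norm u)\<^sup>2 = (\<Sum>i. (u \<bullet> ebasis (Suc i))\<^sup>2)"
proof -
  have "(\<lambda>n. (norm (\<Sum>i<n. (u \<bullet> ebasis (Suc i)) *\<^sub>R ebasis (Suc i)))\<^sup>2) \<longlonglongrightarrow> (norm u)\<^sup>2"
    by (intro tendsto_intros ebasis_expansion[unfolded sums_def])
  then have "(\<lambda>i. (u \<bullet> ebasis (Suc i))\<^sup>2) sums (norm u)\<^sup>2"
    by (simp add: norm_sum_ebasis sums_def)
  then show ?thesis by (rule sums_unique)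
qed

lemma diag_dom_mono:
  assumes "u \<in> diag_dom b" "\<And>i. \<bar>a (Suc i)\<bar> \<le> b (Suc i)" shows "u \<in> diag_dom a"
  unfolding diag_dom_def mem_Collect_eq
proof (rule summable_comparison_test'[where N = 0])
  show "summable (\<lambda>i. (b (Suc i) * (u \<bullet> ebasis (Suc i)))\<^sup>2)"
    using assms(1) by (simp add: diag_dom_def)
  fix i :: nat
  have "(a (Suc i))\<^sup>2 \<le> (b (Suc i))\<^sup>2"
    using power_mono[OF assms(2)[of i], of 2] by simp
  then show "norm ((a (Suc i) * (u \<bullet> ebasis (Suc i)))\<^sup>2) \<le> (b (Suc i) * (u \<bullet> ebasis (Suc i)))\<^sup>2"
    by (simp add: power_mult_distrib mult_right_mono)
qed

lemma diag_op_tendsto: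
  fixes F :: "'a filter"
  assumes lim: "\<And>i. ((\<lambda>x. a x (Suc i)) \<longlongrightarrow> a' (Suc i)) F"
    and bd: "\<forall>\<^sub>F x in F. \<forall>i. \<bar>a x (Suc i)\<bar> \<le> B (Suc i)" and u: "u \<in> diag_dom B" and F: "F \<noteq> bot"
  shows "((\<lambda>x. diag_op (a x) u) \<longlongrightarrow> diag_op a' u) F"
proof -
  let ?c = "\<lambda>i. u \<bullet> ebasis (Suc i)"
  have bd': "\<bar>a' (Suc i)\<bar> \<le> B (Suc i)" for i
  proof (rule tendsto_upperbound[OF tendsto_rabs[OF lim[of i]] _ F])
    show "\<forall>\<^sub>F x in F. \<bar>a x (Suc i)\<bar> \<le> B (Suc i)"
      using bd by (rule eventually_mono) simp
  qed
  have u': "u \<in> diag_dom a'" by (rule diag_dom_mono[OF u bd'])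
  have norm_eq: "(norm (diag_op (a x) u - diag_op a' u))\<^sup>2 = (\<Sum>i. ((a x (Suc i) - a' (Suc i)) * ?c i)\<^sup>2)"
    if "\<forall>i. \<bar>a x (Suc i)\<bar> \<le> B (Suc i)" for x
  proof -
    have "u \<in> diag_dom (a x)" using that by (intro diag_dom_mono[OF u]) simp
    then show ?thesis
      using u' unfolding norm_ebasis_suminf[of "diag_op (a x) u - diag_op a' u"]
      by (simp add: inner_diff_left diag_op_inner left_diff_distrib)
  qed
  have "((\<lambda>x. \<Sum>i. ((a x (Suc i) - a' (Suc i)) * ?c i)\<^sup>2) \<longlongrightarrow> (\<Sum>i. (0::real))) F"
  proof (rule tannerys_theorem[THEN conjunct2, THEN conjunct2])
    fix i
    have "((\<lambda>x. ((a x (Suc i) - a' (Suc i)) * ?c i)\<^sup>2) \<longlongrightarrow> ((a' (Suc i) - a' (Suc i)) * ?c i)\<^sup>2) F"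
      by (intro tendsto_intros lim)
    then show "((\<lambda>x. ((a x (Suc i) - a' (Suc i)) * ?c i)\<^sup>2) \<longlongrightarrow> 0) F" by simp
  next
    have "norm (((a x (Suc i) - a' (Suc i)) * ?c i)\<^sup>2) \<le> 4 * (B (Suc i) * ?c i)\<^sup>2"
      if "\<forall>i. \<bar>a x (Suc i)\<bar> \<le> B (Suc i)" for x i
    proof -
      have "\<bar>a x (Suc i) - a' (Suc i)\<bar> \<le> 2 * B (Suc i)"
        using spec[OF that, of i] bd'[of i] by linarith
      from power_mono[OF this, of 2] have "(a x (Suc i) - a' (Suc i))\<^sup>2 \<le> 4 * (B (Suc i))\<^sup>2"
        by (simp add: power_mult_distrib)
      from mult_right_mono[OF this, of "(?c i)\<^sup>2"] show ?thesis
        by (simp add: power_mult_distrib mult.assoc)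
    qed
    then show "\<forall>\<^sub>F (i, x) in at_top \<times>\<^sub>F F.
        norm (((a x (Suc i) - a' (Suc i)) * ?c i)\<^sup>2) \<le> 4 * (B (Suc i) * ?c i)\<^sup>2"
      unfolding eventually_prod_filter using bd
      by (intro exI[of _ "\<lambda>_. True"] exI[of _ "\<lambda>x. \<forall>i. \<bar>a x (Suc i)\<bar> \<le> B (Suc i)"]) simp
    show "summable (\<lambda>i. 4 * (B (Suc i) * ?c i)\<^sup>2)"
      using u unfolding diag_dom_def by (intro summable_mult) simp
  qed (rule F)
  moreover have "\<forall>\<^sub>F x in F. (\<Sum>i. ((a x (Suc i) - a' (Suc i)) * ?c i)\<^sup>2)
      = (norm (diag_op (a x) u - diag_op a' u))\<^sup>2"
    using bd by (rule eventually_mono) (simp add: norm_eq)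
  ultimately have "((\<lambda>x. (norm (diag_op (a x) u - diag_op a' u))\<^sup>2) \<longlongrightarrow> 0) F"
    by (simp add: tendsto_cong)
  from tendsto_real_sqrt[OF this] have "((\<lambda>x. norm (diag_op (a x) u - diag_op a' u)) \<longlongrightarrow> 0) F"
    by simp
  then show ?thesis
    by (rule LIM_zero_cancel[OF tendsto_norm_zero_cancel])
qed

lemma diag_dom_1: "u \<in> diag_dom (\<lambda>i. 1)"
  using bessel_ebasis[of u] by (simp add: diag_dom_def)

lemma heat_bound: "t \<ge> 0 \<Longrightarrow> \<bar>exp (- eigval i * t)\<bar> \<le> 1"
  by (simp add: eigval_def)

lemma heat_dom: "t \<ge> 0 \<Longrightarrow> u \<in> diag_dom (\<lambda>i. exp (- eigval i * t))"
  using heat_bound by (intro diag_dom_mono[OF diag_dom_1])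

lemma heat_inner:
  "t \<ge> 0 \<Longrightarrow> heat t u \<bullet> ebasis (Suc i) = exp (- eigval (Suc i) * t) * (u \<bullet> ebasis (Suc i))"
  unfolding heat_def by (rule diag_op_inner[OF heat_dom])

lemma heat_0: "heat 0 u = u"
  by (rule L2_eqI) (simp add: heat_inner)

lemma heat_add: "s \<ge> 0 \<Longrightarrow> t \<ge> 0 \<Longrightarrow> heat (s + t) u = heat s (heat t u)"
  by (rule L2_eqI) (simp add: heat_inner exp_add[symmetric] algebra_simps flip: mult.assoc)

lemma heat_bounded_linear:
  assumes "t \<ge> 0" shows "bounded_linear (heat t)"
proof (rule bounded_linear_intro[of _ 1])
  show "heat t (u + v) = heat t u + heat t v" for u v
    by (rule L2_eqI) (simp add: heat_inner assms inner_add_left distrib_left)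
  show "heat t (c *\<^sub>R u) = c *\<^sub>R heat t u" for c u
    by (rule L2_eqI) (simp add: heat_inner assms)
  show "norm (heat t u) \<le> norm u * 1" for u
  proof (rule power2_le_imp_le)
    have "(heat t u \<bullet> ebasis (Suc i))\<^sup>2 \<le> (u \<bullet> ebasis (Suc i))\<^sup>2" for i
      using mult_right_mono[OF power_mono[OF heat_bound[OF assms, of "Suc i"], of 2], of "(u \<bullet> ebasis (Suc i))\<^sup>2"]
      by (simp add: heat_inner assms power_mult_distrib)
    then show "(norm (heat t u))\<^sup>2 \<le> (norm u * 1)\<^sup>2"
      unfolding norm_ebasis_suminf mult_1_right by (intro suminf_le bessel_ebasis)
  qed simp
qed

lemma heat_continuous: "continuous_on {0..} (\<lambda>t. heat t u)"
  unfolding continuous_on_def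
proof
  fix t :: real assume t: "t \<in> {0..}"
  show "((\<lambda>t. heat t u) \<longlongrightarrow> heat t u) (at t within {0..})"
    unfolding heat_def
  proof (rule diag_op_tendsto[OF _ _ diag_dom_1])
    show "((\<lambda>x. exp (- eigval (Suc i) * x)) \<longlongrightarrow> exp (- eigval (Suc i) * t)) (at t within {0..})" for i
      by (intro tendsto_intros)
    show "\<forall>\<^sub>F x in at t within {0..}. \<forall>i. \<bar>exp (- eigval (Suc i) * x)\<bar> \<le> 1"
      unfolding eventually_at_filter using heat_bound by (intro always_eventually) simp
    have "at_right t \<le> at t within {0..}"
      using t by (intro at_le) auto
    then show "at t within {0..} \<noteq> bot"
      using trivial_limit_at_right_real[of t] by (metis bot_unique)
  qed
qed

lemma heat_generator:
  "((\<lambda>h. (heat h u - u) /\<^sub>R h) \<longlongrightarrow> v) (at_right 0) \<longleftrightarrow> u \<in> dom_lap \<and> lap u = v"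
proof
  assume lim: "((\<lambda>h. (heat h u - u) /\<^sub>R h) \<longlongrightarrow> v) (at_right 0)"
  have v: "v \<bullet> ebasis (Suc i) = - eigval (Suc i) * (u \<bullet> ebasis (Suc i))" for i
  proof (rule tendsto_unique[OF trivial_limit_at_right_real])
    show "((\<lambda>h. ((heat h u - u) /\<^sub>R h) \<bullet> ebasis (Suc i)) \<longlongrightarrow> v \<bullet> ebasis (Suc i)) (at_right 0)"
      by (intro tendsto_intros lim)
    have "((\<lambda>h. exp (- eigval (Suc i) * h)) has_real_derivative - eigval (Suc i)) (at 0)"
      by (auto intro!: derivative_eq_intros)
    then have "((\<lambda>h. (exp (- eigval (Suc i) * h) - 1) / h) \<longlongrightarrow> - eigval (Suc i)) (at 0)"
      by (simp add: DERIV_def)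
    then have "((\<lambda>h. (exp (- eigval (Suc i) * h) - 1) / h) \<longlongrightarrow> - eigval (Suc i)) (at_right 0)"
      by (rule tendsto_within_subset[OF _ subset_UNIV])
    then have "((\<lambda>h. (exp (- eigval (Suc i) * h) - 1) / h * (u \<bullet> ebasis (Suc i)))
        \<longlongrightarrow> - eigval (Suc i) * (u \<bullet> ebasis (Suc i))) (at_right 0)"
      by (intro tendsto_intros)
    moreover have "\<forall>\<^sub>F h in at_right 0. (exp (- eigval (Suc i) * h) - 1) / h * (u \<bullet> ebasis (Suc i))
        = ((heat h u - u) /\<^sub>R h) \<bullet> ebasis (Suc i)"
      unfolding eventually_at_filter
      by (intro always_eventually) (auto simp: heat_inner inner_diff_left field_simps)
    ultimately show "((\<lambda>h. ((heat h u - u) /\<^sub>R h) \<bullet> ebasis (Suc i))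
        \<longlongrightarrow> - eigval (Suc i) * (u \<bullet> ebasis (Suc i))) (at_right 0)"
      by (rule Lim_transform_eventually)
  qed
  have "u \<in> dom_lap"
    using bessel_ebasis[of v] by (simp add: dom_lap_eq diag_dom_def v)
  moreover have "lap u = v"
    by (rule L2_eqI) (simp add: v lap_coeff[OF \<open>u \<in> dom_lap\<close>])
  ultimately show "u \<in> dom_lap \<and> lap u = v" ..
next
  assume "u \<in> dom_lap \<and> lap u = v"
  then have u: "u \<in> diag_dom eigval" and v: "v = - diag_op eigval u"
    using lap_eq dom_lap_eq by auto
  have "((\<lambda>h. diag_op (\<lambda>i. (1 - exp (- eigval i * h)) / h) u) \<longlongrightarrow> diag_op eigval u) (at_right 0)"
  proof (rule diag_op_tendsto[OF _ _ u trivial_limit_at_right_real])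
    fix i
    have "((\<lambda>h. - exp (- eigval (Suc i) * h)) has_real_derivative eigval (Suc i)) (at 0)"
      by (auto intro!: derivative_eq_intros)
    then have "((\<lambda>h. (1 - exp (- eigval (Suc i) * h)) / h) \<longlongrightarrow> eigval (Suc i)) (at 0)"
      by (simp add: DERIV_def)
    then show "((\<lambda>h. (1 - exp (- eigval (Suc i) * h)) / h) \<longlongrightarrow> eigval (Suc i)) (at_right 0)"
      by (rule tendsto_within_subset[OF _ subset_UNIV])
  next
    have "\<bar>(1 - exp (- eigval (Suc i) * h)) / h\<bar> \<le> eigval (Suc i)" if "h > 0" for h i
    proof -
      have "1 - eigval (Suc i) * h \<le> exp (- eigval (Suc i) * h)"
        using exp_ge_add_one_self[of "- eigval (Suc i) * h"] by simp
      moreover have "exp (- eigval (Suc i) * h) \<le> 1"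
        using that heat_bound[of h "Suc i"] by simp
      ultimately show ?thesis
        using that by (simp add: field_simps)
    qed
    then show "\<forall>\<^sub>F h in at_right 0. \<forall>i. \<bar>(1 - exp (- eigval (Suc i) * h)) / h\<bar> \<le> eigval (Suc i)"
      unfolding eventually_at_filter by (intro always_eventually) simp
  qed
  from tendsto_minus[OF this]
  have "((\<lambda>h. - diag_op (\<lambda>i. (1 - exp (- eigval i * h)) / h) u) \<longlongrightarrow> v) (at_right 0)"
    by (simp add: v)
  moreover have "- diag_op (\<lambda>i. (1 - exp (- eigval i * h)) / h) u = (heat h u - u) /\<^sub>R h" if "h > 0" for h
  proof (rule L2_eqI)
    fix i
    have "u \<in> diag_dom (\<lambda>i. (1 / h) * 1)"
      using bessel_ebasis[of u] by (simp add: diag_dom_def power_mult_distrib power_divide summable_divide)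
    then have "u \<in> diag_dom (\<lambda>i. (1 - exp (- eigval i * h)) / h)"
    proof (rule diag_dom_mono)
      show "\<bar>(1 - exp (- eigval (Suc i) * h)) / h\<bar> \<le> (1 / h) * 1" for i
        using that heat_bound[of h "Suc i"] by (simp add: divide_right_mono)
    qed
    then show "- diag_op (\<lambda>i. (1 - exp (- eigval i * h)) / h) u \<bullet> ebasis (Suc i)
        = ((heat h u - u) /\<^sub>R h) \<bullet> ebasis (Suc i)"
      using that by (simp add: diag_op_inner heat_inner inner_diff_left field_simps)
  qed
  then have "\<forall>\<^sub>F h in at_right 0. - diag_op (\<lambda>i. (1 - exp (- eigval i * h)) / h) u = (heat h u - u) /\<^sub>R h"
    unfolding eventually_at_filter by (intro always_eventually) simp
  ultimately show "((\<lambda>h. (heat h u - u) /\<^sub>R h) \<longlongrightarrow> v) (at_right 0)"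
    by (rule Lim_transform_eventually)
qed


subsection \<open>Fractional powers, square roots, Hilbert--Schmidt operators\<close>

definition frac_dom :: "real \<Rightarrow> L2 set" where
  "frac_dom s = diag_dom (\<lambda>i. eigval i powr s)"

definition frac_pow :: "real \<Rightarrow> L2 \<Rightarrow> L2" where
  "frac_pow s = diag_op (\<lambda>i. eigval i powr s)"

text \<open>\<open>hdot \<gamma>\<close> is used for \<open>\<gamma> \<ge> 0\<close> only; for negative \<open>\<gamma>\<close> one would have to complete.\<close>

definition hdot :: "real \<Rightarrow> L2 set" where
  "hdot \<gamma> = frac_dom (\<gamma> / 2)"

definition hdot_norm :: "real \<Rightarrow> L2 \<Rightarrow> real" where
  "hdot_norm \<gamma> u = norm (frac_pow (\<gamma> / 2) u)"

definition self_adjoint :: "(L2 \<Rightarrow> L2) \<Rightarrow> bool" where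
  "self_adjoint T \<longleftrightarrow> (\<forall>u v. T u \<bullet> v = u \<bullet> T v)"

definition is_sqrt_op :: "(L2 \<Rightarrow> L2) \<Rightarrow> (L2 \<Rightarrow> L2) \<Rightarrow> bool" where
  "is_sqrt_op Q R \<longleftrightarrow>
     bounded_linear R \<and> self_adjoint R \<and> (\<forall>u. 0 \<le> R u \<bullet> u) \<and> (\<forall>u. R (R u) = Q u)"

text \<open>The positive square root is unique and exists for the covariance operators considered here, see lemma
  \<open>sqrt_op_correct\<close>.\<close>

definition sqrt_op :: "(L2 \<Rightarrow> L2) \<Rightarrow> L2 \<Rightarrow> L2" where
  "sqrt_op Q = (THE R. is_sqrt_op Q R)"

text \<open>The sum does not depend on the choice of the orthonormal basis.\<close>

definition hilbert_schmidt :: "(L2 \<Rightarrow> L2) \<Rightarrow> bool" where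
  "hilbert_schmidt T \<longleftrightarrow> bounded_linear T \<and> summable (\<lambda>i. (norm (T (ebasis (Suc i))))\<^sup>2)"

lemma sqrt_op_ebasis_aux:
  assumes "bounded_linear Q" "is_sqrt_op Q R" "Q e = q *\<^sub>R e" "q > 0"
  shows "R e = sqrt q *\<^sub>R e"
proof -
  interpret R: bounded_linear R using assms(2) by (simp add: is_sqrt_op_def)
  have RR: "R (R u) = Q u" and pos: "0 \<le> R u \<bullet> u" for u
    using assms(2) by (simp_all add: is_sqrt_op_def)
  define w where "w = R e - sqrt q *\<^sub>R e"
  have "R w = - sqrt q *\<^sub>R w"
    using assms(3,4) by (simp add: w_def R.diff R.scaleR RR scaleR_diff_right)
  then have "0 \<le> - sqrt q * (w \<bullet> w)" using pos[of w] by simp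
  then have "w \<bullet> w \<le> 0"
    using assms(4) by (simp add: mult_le_0_iff)
  then have "w \<bullet> w = 0" using inner_ge_zero[of w] by (rule antisym)
  then have "w = 0" by simp
  then show ?thesis by (simp add: w_def)
qed

lemma sqrt_op_correct:
  assumes Q: "bounded_linear Q" "self_adjoint Q"
    and q: "\<And>i. i \<ge> 1 \<Longrightarrow> Q (ebasis i) = q i *\<^sub>R ebasis i" "\<And>i. i \<ge> 1 \<Longrightarrow> q i > 0"
  shows "is_sqrt_op Q (sqrt_op Q)"
    and "i \<ge> 1 \<Longrightarrow> sqrt_op Q (ebasis i) = sqrt (q i) *\<^sub>R ebasis i"
proof -
  define R where "R = diag_op (\<lambda>i. sqrt (q i))"
  obtain K where K: "K > 0" "\<And>u. norm (Q u) \<le> norm u * K"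
    using bounded_linear.pos_bounded[OF Q(1)] by blast
  have qK: "q (Suc i) \<le> K" for i
  proof -
    have "q (Suc i) = norm (Q (ebasis (Suc i)))"
      using q[of "Suc i"] by (simp add: norm_eq_sqrt_inner ebasis_norm)
    also have "\<dots> \<le> K"
      using K(2)[of "ebasis (Suc i)"] by (simp add: norm_eq_sqrt_inner[of "ebasis _"] ebasis_norm)
    finally show ?thesis .
  qed
  have dom: "u \<in> diag_dom (\<lambda>i. sqrt (q i))" for u
  proof (rule diag_dom_mono)
    show "u \<in> diag_dom (\<lambda>i. sqrt K)"
      using summable_mult[OF bessel_ebasis[of u], of "(sqrt K)\<^sup>2"]
      by (simp add: diag_dom_def power_mult_distrib)
    show "\<bar>sqrt (q (Suc i))\<bar> \<le> sqrt K" for i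
      using qK[of i] q(2)[of "Suc i"] by simp
  qed
  have Ri: "R u \<bullet> ebasis (Suc i) = sqrt (q (Suc i)) * (u \<bullet> ebasis (Suc i))" for u i
    unfolding R_def by (rule diag_op_inner[OF dom])
  have "bounded_linear R"
  proof (rule bounded_linear_intro[of _ "sqrt K"])
    show "R (u + v) = R u + R v" for u v
      by (rule L2_eqI) (simp add: Ri inner_add_left distrib_left)
    show "R (c *\<^sub>R u) = c *\<^sub>R R u" for c u
      by (rule L2_eqI) (simp add: Ri)
    show "norm (R u) \<le> norm u * sqrt K" for u
    proof (rule power2_le_imp_le)
      have le: "(R u \<bullet> ebasis (Suc i))\<^sup>2 \<le> K * (u \<bullet> ebasis (Suc i))\<^sup>2" for i
        using qK[of i] q(2)[of "Suc i"] by (simp add: Ri power_mult_distrib mult_right_mono)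
      have "(norm (R u))\<^sup>2 \<le> (\<Sum>i. K * (u \<bullet> ebasis (Suc i))\<^sup>2)"
        unfolding norm_ebasis_suminf by (intro suminf_le le bessel_ebasis summable_mult)
      also have "\<dots> = K * (norm u)\<^sup>2"
        unfolding norm_ebasis_suminf by (rule suminf_mult[OF bessel_ebasis])
      finally show "(norm (R u))\<^sup>2 \<le> (norm u * sqrt K)\<^sup>2"
        using K(1) by (simp add: power_mult_distrib mult.commute)
    qed (use K(1) in simp)
  qed
  moreover have Ruv: "(\<lambda>i. (R u \<bullet> ebasis (Suc i)) * (v \<bullet> ebasis (Suc i))) sums (R u \<bullet> v)" for u v
    using bounded_linear.sums[OF bounded_linear_inner_right ebasis_expansion, of "R u" v]
    by (simp add: mult.commute)
  moreover have "self_adjoint R"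
    unfolding self_adjoint_def
  proof (intro allI)
    fix u v
    have "(\<lambda>i. (R u \<bullet> ebasis (Suc i)) * (v \<bullet> ebasis (Suc i)))
        = (\<lambda>i. (R v \<bullet> ebasis (Suc i)) * (u \<bullet> ebasis (Suc i)))"
      by (simp add: Ri fun_eq_iff)
    then have "R u \<bullet> v = R v \<bullet> u"
      using Ruv[of u v] Ruv[of v u] by (metis sums_unique2)
    then show "R u \<bullet> v = u \<bullet> R v" by (simp add: inner_commute)
  qed
  moreover have "0 \<le> R u \<bullet> u" for u
  proof -
    have "0 \<le> (R u \<bullet> ebasis (Suc i)) * (u \<bullet> ebasis (Suc i))" for i
      using q(2)[of "Suc i"] by (simp add: Ri mult.assoc)
    then show ?thesis using Ruv[of u u] sums_le[OF _ sums_zero Ruv[of u u]] by blast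
  qed
  moreover have "R (R u) = Q u" for u
  proof (rule L2_eqI)
    fix i
    have "Q u \<bullet> ebasis (Suc i) = q (Suc i) * (u \<bullet> ebasis (Suc i))"
      using Q(2) q(1)[of "Suc i"] by (simp add: self_adjoint_def)
    then show "R (R u) \<bullet> ebasis (Suc i) = Q u \<bullet> ebasis (Suc i)"
      using q(2)[of "Suc i"] by (simp add: Ri flip: mult.assoc)
  qed
  ultimately have R: "is_sqrt_op Q R" by (simp add: is_sqrt_op_def)
  have uniq: "R' = R" if R': "is_sqrt_op Q R'" for R'
  proof
    fix u
    show "R' u = R u"
    proof (rule L2_eqI)
      fix i
      have "R' u \<bullet> ebasis (Suc i) = u \<bullet> R' (ebasis (Suc i))"
        using R' by (simp add: is_sqrt_op_def self_adjoint_def)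
      also have "R' (ebasis (Suc i)) = sqrt (q (Suc i)) *\<^sub>R ebasis (Suc i)"
        by (rule sqrt_op_ebasis_aux[OF Q(1) R']) (use q in simp_all)
      finally show "R' u \<bullet> ebasis (Suc i) = R u \<bullet> ebasis (Suc i)" by (simp add: Ri)
    qed
  qed
  show *: "is_sqrt_op Q (sqrt_op Q)"
    unfolding sqrt_op_def by (rule theI[of "is_sqrt_op Q", OF R uniq])
  show "sqrt_op Q (ebasis i) = sqrt (q i) *\<^sub>R ebasis i" if "i \<ge> 1"
    using sqrt_op_ebasis_aux[OF Q(1) * q(1)[OF that] q(2)[OF that]] .
qed

subsection \<open>Galerkin spaces\<close>

definition galerkin_space :: "nat \<Rightarrow> L2 set" where
  "galerkin_space n = span (ebasis ` {1..n})"

definition galerkin_proj :: "nat \<Rightarrow> L2 \<Rightarrow> L2" where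
  "galerkin_proj n u = (\<Sum>i=1..n. (u \<bullet> ebasis i) *\<^sub>R ebasis i)"

definition op_exp :: "(L2 \<Rightarrow> L2) \<Rightarrow> real \<Rightarrow> L2 \<Rightarrow> L2" where
  "op_exp T t u = (\<Sum>k. (t ^ k / fact k) *\<^sub>R (T ^^ k) u)"

subsection \<open>Rate functions\<close>

text \<open>Representatives of the elements of \<open>L\<^sup>2(0,T;X)\<close>; every quantity below depends only on the class
  of \<open>\<phi>\<close> modulo almost-everywhere equality.\<close>

definition controls :: "L2 set \<Rightarrow> real \<Rightarrow> (real \<Rightarrow> L2) set" where
  "controls X T = {\<phi>. \<phi> \<in> borel_measurable (lebesgue_on {0<..<T}) \<and>
     integrable (lebesgue_on {0<..<T}) (\<lambda>s. (norm (\<phi> s))\<^sup>2) \<and>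
     (AE s in lebesgue_on {0<..<T}. \<phi> s \<in> X)}"

text \<open>\<open>z(t) = S(t)x + \<integral>\<^sub>0\<^sup>t S(t - s)(G(z(s)) + B \<phi>(s)) ds\<close> on \<open>[0,T]\<close>, with a Bochner integral. For the
  generators \<open>A\<close> and \<open>A\<^sub>n\<close> and Lipschitz \<open>G\<close> the solution is unique on \<open>[0,T]\<close>; only the values of \<open>z\<close> on
  \<open>[0,T]\<close> matter.\<close>

definition mild_solution ::
  "(real \<Rightarrow> L2 \<Rightarrow> L2) \<Rightarrow> (L2 \<Rightarrow> L2) \<Rightarrow> (L2 \<Rightarrow> L2) \<Rightarrow> real \<Rightarrow> L2 \<Rightarrow> (real \<Rightarrow> L2) \<Rightarrow> (real \<Rightarrow> L2) \<Rightarrow> bool"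
where
  "mild_solution S G B T x \<phi> z \<longleftrightarrow> continuous_on {0..T} z \<and>
     (\<forall>t\<in>{0..T}.
        integrable (lebesgue_on {0<..<t}) (\<lambda>s. S (t - s) (G (z s) + B (\<phi> s))) \<and>
        z t = S t x + (LINT s|lebesgue_on {0<..<t}. S (t - s) (G (z s) + B (\<phi> s))))"

text \<open>The infimum of the empty set is \<open>\<infinity>\<close>.\<close>

definition action ::
  "(real \<Rightarrow> L2 \<Rightarrow> L2) \<Rightarrow> (L2 \<Rightarrow> L2) \<Rightarrow> (L2 \<Rightarrow> L2) \<Rightarrow> L2 set \<Rightarrow> real \<Rightarrow> L2 \<Rightarrow> (real \<Rightarrow> L2) \<Rightarrow> ereal"
where
  "action S G B X T x z = ereal (1 / 2) *
     Inf {ereal (LINT s|lebesgue_on {0<..<T}. (norm (\<phi> s))\<^sup>2) |\<phi>.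
            \<phi> \<in> controls X T \<and> mild_solution S G B T x \<phi> z}"

definition quasi_potential ::
  "(real \<Rightarrow> L2 \<Rightarrow> L2) \<Rightarrow> (L2 \<Rightarrow> L2) \<Rightarrow> (L2 \<Rightarrow> L2) \<Rightarrow> L2 set \<Rightarrow> L2 \<Rightarrow> ereal"
where
  "quasi_potential S G B X u = Inf {action S G B X T 0 z |T z.
     T > 0 \<and> continuous_on {0..T} z \<and> z ` {0..T} \<subseteq> X \<and> z 0 = 0 \<and> z T = u}"

definition V_rate :: "(L2 \<Rightarrow> L2) \<Rightarrow> (L2 \<Rightarrow> L2) \<Rightarrow> L2 \<Rightarrow> ereal" where
  "V_rate Q F = quasi_potential heat F (sqrt_op Q) UNIV"

text \<open>Here \<open>A\<^sub>n = P\<^sub>n A\<close>, \<open>F\<^sub>n = P\<^sub>n F\<close> and \<open>Q\<^sub>n\<^sup>1\<^sup>/\<^sup>2 = P\<^sub>n Q\<^sup>1\<^sup>/\<^sup>2\<close>. The state and the controls take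
  values in \<open>H\<^sub>n\<close>, on which \<open>A\<^sub>n\<close> is bounded, so \<open>e\<^bsup>tA\<^sub>n\<^esup>\<close> is the exponential series. Intended for arguments
  in \<open>H\<^sub>n\<close>.\<close>

definition V_galerkin :: "nat \<Rightarrow> (L2 \<Rightarrow> L2) \<Rightarrow> (L2 \<Rightarrow> L2) \<Rightarrow> L2 \<Rightarrow> ereal" where
  "V_galerkin n Q F = quasi_potential
     (op_exp (\<lambda>v. galerkin_proj n (lap v))) (\<lambda>v. galerkin_proj n (F v))
     (\<lambda>v. galerkin_proj n (sqrt_op Q v)) (galerkin_space n)"

end

theory Submission
  imports Defs
begin

text \<open>
  For \<open>F = 0\<close> the control problem decouples over the modes \<open>e\<^sub>i\<close>, and both rate functions are sandwiched by
  the energy \<open>E(u) = \<Sum>i. \<lambda>\<^sub>i u\<^sub>i\<^sup>2 / q\<^sub>i\<close> and its partial sums \<open>E\<^sub>n(u)\<close>: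
  \<open>E\<^sub>n(u) \<le> V\<^sup>n(P\<^sub>n u) \<le> V(u) \<le> E(u)\<close>.
  The first inequality is Cauchy--Schwarz in each mode, the second holds because \<open>P\<^sub>n\<close> maps controlled paths to
  controlled Galerkin paths without increasing the cost, and the third comes from the control whose \<open>i\<close>-th mode
  is proportional to \<open>exp (- \<lambda>\<^sub>i (T - s))\<close>, letting \<open>T\<close> tend to infinity. If \<open>V(u)\<close> is finite, then
  so is \<open>E(u)\<close> and \<open>E\<^sub>n(u)\<close> converges to it, so \<open>u\<^sub>n = P\<^sub>n u\<close> works for all large \<open>n\<close>.\<close>

section \<open>Quasi-potentials and single controlled paths\<close>

text \<open>Both infima are handled at once, so that lower bounds need only be checked on one
  control and its path. A path without controls has action \<infinity> and meets the bound
  trivially.\<close>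

lemma quasi_potential_geI:
  assumes "\<And>T z \<phi>. T > 0 \<Longrightarrow> z ` {0..T} \<subseteq> X \<Longrightarrow> z 0 = 0 \<Longrightarrow> z T = u \<Longrightarrow>
    \<phi> \<in> controls X T \<Longrightarrow> mild_solution S G B T 0 \<phi> z \<Longrightarrow>
    x \<le> ereal (1 / 2 * (LINT s|lebesgue_on {0<..<T}. (norm (\<phi> s))\<^sup>2))"
  shows "x \<le> quasi_potential S G B X u"
  unfolding quasi_potential_def
proof (rule Inf_greatest, clarify)
  fix T :: real and z
  assume z: "T > 0" "z ` {0..T} \<subseteq> X" "z 0 = 0" "u = z T"
  \<comment> \<open>The factor 1/2 stands outside the inner infimum; comparing with
    \<open>2 * x\<close> moves it to the other side.\<close>
  have "ereal 2 * x \<le> Inf {ereal (LINT s|lebesgue_on {0<..<T}. (norm (\<phi> s))\<^sup>2) |\<phi>.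
            \<phi> \<in> controls X T \<and> mild_solution S G B T 0 \<phi> z}"
  proof (rule Inf_greatest, clarify)
    fix \<phi> assume "\<phi> \<in> controls X T" "mild_solution S G B T 0 \<phi> z"
    with assms[of T z \<phi>] z
    have "x \<le> ereal (1 / 2 * (LINT s|lebesgue_on {0<..<T}. (norm (\<phi> s))\<^sup>2))" by simp
    then show "ereal 2 * x \<le> ereal (LINT s|lebesgue_on {0<..<T}. (norm (\<phi> s))\<^sup>2)"
      by (cases x) auto
  qed
  then have "ereal (1/2) * (ereal 2 * x) \<le> action S G B X T 0 z"
    unfolding action_def by (intro ereal_mult_left_mono) simp_all
  then show "x \<le> action S G B X T 0 z" by (simp flip: mult.assoc)
qed

lemma quasi_potential_leI:
  assumes "T > 0" "z ` {0..T} \<subseteq> X" "z 0 = 0" "z T = u"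
    "\<phi> \<in> controls X T" "mild_solution S G B T 0 \<phi> z"
  shows "quasi_potential S G B X u
    \<le> ereal (1 / 2 * (LINT s|lebesgue_on {0<..<T}. (norm (\<phi> s))\<^sup>2))"
proof -
  have "continuous_on {0..T} z"
    using assms(6) by (simp add: mild_solution_def)
  then have "quasi_potential S G B X u \<le> action S G B X T 0 z"
    unfolding quasi_potential_def using assms(1-4) by (intro Inf_lower) blast
  also have "\<dots> \<le> ereal (1/2) * ereal (LINT s|lebesgue_on {0<..<T}. (norm (\<phi> s))\<^sup>2)"
    unfolding action_def using assms(5,6) by (intro ereal_mult_left_mono Inf_lower) auto
  finally show ?thesis by simp
qed

section \<open>Integration and measurability\<close>

text \<open>Continuity gives absolute integrability on the compact interval, and the endpoints form
  a null set, so the gauge-integral theorem yields the Lebesgue integral over the open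
  interval.\<close>

lemma has_bochner_integral_FTC_Ioo:
  fixes F f :: "real \<Rightarrow> real"
  assumes "a \<le> b" "\<And>x. (F has_real_derivative f x) (at x)" "continuous_on UNIV f"
  shows "has_bochner_integral (lebesgue_on {a<..<b}) f (F b - F a)"
proof -
  have "f absolutely_integrable_on {a..b}"
    by (intro absolutely_integrable_continuous_real continuous_on_subset[OF assms(3)]) auto
  then have "f absolutely_integrable_on {a<..<b}"
    by (rule set_integrable_subset) auto
  then have i: "integrable (lebesgue_on {a<..<b}) f"
    by (simp add: integrable_restrict_space set_integrable_def)
  have "(f has_integral (F b - F a)) {a..b}"
    using assms(1,2)
    by (intro fundamental_theorem_of_calculus)
       (auto simp: has_real_derivative_iff_has_vector_derivative[symmetric] intro: has_field_derivative_at_within)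
  then have "(f has_integral (F b - F a)) {a<..<b}"
    by (simp add: has_integral_Icc_iff_Ioo)
  moreover have "(f has_integral (LINT x|lebesgue_on {a<..<b}. f x)) {a<..<b}"
    by (intro has_integral_integral_lebesgue_on i) simp
  ultimately show ?thesis
    using i has_integral_unique by (auto simp: has_bochner_integral_iff)
qed

text \<open>The sine expansion converges pointwise and a series of measurable terms is measurable: a
  concrete form of Pettis' theorem.\<close>

lemma borel_measurable_L2I:
  fixes f :: "'a \<Rightarrow> L2"
  assumes "\<And>i. (\<lambda>x. f x \<bullet> ebasis (Suc i)) \<in> borel_measurable M"
  shows "f \<in> borel_measurable M"
proof -
  have "(\<lambda>x. \<Sum>i. (f x \<bullet> ebasis (Suc i)) *\<^sub>R ebasis (Suc i)) \<in> borel_measurable M"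
    using assms by measurable
  then show ?thesis
    using sums_unique[OF ebasis_expansion] by simp
qed

section \<open>Galerkin projections and their ranges\<close>

lemma galerkin_proj_eq:
  "galerkin_proj n u = (\<Sum>j<n. (u \<bullet> ebasis (Suc j)) *\<^sub>R ebasis (Suc j))"
  unfolding galerkin_proj_def
  by (rule sum.reindex_bij_witness[of _ Suc "\<lambda>j. j - 1"]) auto

lemma galerkin_proj_inner:
  "galerkin_proj n u \<bullet> ebasis (Suc i) = (if i < n then u \<bullet> ebasis (Suc i) else 0)"
  by (simp add: galerkin_proj_eq inner_sum_left ebasis_orthonormal if_distrib cong: if_cong)

lemma galerkin_proj_mem: "galerkin_proj n u \<in> galerkin_space n"
  unfolding galerkin_proj_def galerkin_space_def by (intro span_sum span_scale span_base) auto

text \<open>Parseval's identity. It serves for the contraction property of P_n and for that of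
  \<open>heat\<close>.\<close>

lemma norm_mono_coeff:
  assumes "\<And>i. \<bar>u \<bullet> ebasis (Suc i)\<bar> \<le> c * \<bar>v \<bullet> ebasis (Suc i)\<bar>" "c \<ge> 0"
  shows "norm u \<le> c * norm v"
proof (rule power2_le_imp_le)
  have "(u \<bullet> ebasis (Suc i))\<^sup>2 \<le> c\<^sup>2 * (v \<bullet> ebasis (Suc i))\<^sup>2" for i
    using power_mono[OF assms(1)[of i], of 2] by (simp add: power_mult_distrib)
  then have "(norm u)\<^sup>2 \<le> (\<Sum>i. c\<^sup>2 * (v \<bullet> ebasis (Suc i))\<^sup>2)"
    unfolding norm_ebasis_suminf[of u] by (intro suminf_le bessel_ebasis summable_mult)
  also have "\<dots> = (c * norm v)\<^sup>2"
    unfolding power_mult_distrib norm_ebasis_suminf[of v] by (rule suminf_mult[OF bessel_ebasis])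
  finally show "(norm u)\<^sup>2 \<le> (c * norm v)\<^sup>2" .
qed (use assms(2) in simp)

lemma galerkin_proj_norm_le: "norm (galerkin_proj n u) \<le> norm u"
  using norm_mono_coeff[of "galerkin_proj n u" 1 u] by (simp add: galerkin_proj_inner)

lemma bounded_linear_galerkin_proj: "bounded_linear (galerkin_proj n)"
proof (rule bounded_linear_intro[of _ 1])
  show "galerkin_proj n (u + v) = galerkin_proj n u + galerkin_proj n v" for u v
    by (rule L2_eqI) (simp add: galerkin_proj_inner inner_add_left)
  show "galerkin_proj n (c *\<^sub>R u) = c *\<^sub>R galerkin_proj n u" for c u
    by (rule L2_eqI) (simp add: galerkin_proj_inner)
qed (simp add: galerkin_proj_norm_le)

lemma galerkin_proj_tendsto: "(\<lambda>n. galerkin_proj n u) \<longlonglongrightarrow> u"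
  using ebasis_expansion[of u] by (simp add: sums_def galerkin_proj_eq)

text \<open>Turns membership in a span into a condition on coefficients, which is easy to check for
  \<open>heat\<close>. The converse holds because such a vector is fixed by P_n.\<close>

lemma galerkin_space_iff: "v \<in> galerkin_space n \<longleftrightarrow> (\<forall>i\<ge>n. v \<bullet> ebasis (Suc i) = 0)"
proof
  assume "v \<in> galerkin_space n"
  then show "\<forall>i\<ge>n. v \<bullet> ebasis (Suc i) = 0"
    unfolding galerkin_space_def
  proof (induction rule: span_induct_alt)
    case (step c x y)
    then obtain j where "x = ebasis (Suc j)" "j < n"
      by (auto simp: image_iff) (metis Suc_le_D Suc_le_lessD)
    with step show ?case by (auto simp: inner_add_left ebasis_orthonormal)
  qed simp
next
  assume "\<forall>i\<ge>n. v \<bullet> ebasis (Suc i) = 0"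
  then have "galerkin_proj n v = v"
    by (intro L2_eqI) (auto simp: galerkin_proj_inner)
  then show "v \<in> galerkin_space n"
    using galerkin_proj_mem by metis
qed

lemma galerkin_space_expansion:
  assumes "v \<in> galerkin_space n"
  shows "v = (\<Sum>i<n. (v \<bullet> ebasis (Suc i)) *\<^sub>R ebasis (Suc i))"
  using assms
  by (intro L2_eqI)
     (auto simp: galerkin_space_iff inner_sum_left ebasis_orthonormal if_distrib cong: if_cong)

lemma galerkin_space_subset_dom_lap: "galerkin_space n \<subseteq> dom_lap"
proof
  fix v assume "v \<in> galerkin_space n"
  then have "summable (\<lambda>i. (eigval (Suc i) * (v \<bullet> ebasis (Suc i)))\<^sup>2)"
    by (intro summable_finite[of "{..<n}"]) (auto simp: galerkin_space_iff)
  then show "v \<in> dom_lap"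
    by (simp add: dom_lap_eq diag_dom_def)
qed

section \<open>The Galerkin semigroup and Galerkin controls\<close>

text \<open>On H_n the generator is diagonal, and summing the scalar exponential series over
  finitely many modes gives \<open>heat\<close>. Outside H_n the term k = 0 would keep the high
  modes undamped.\<close>

lemma op_exp_galerkin:
  assumes v: "v \<in> galerkin_space n" and t: "t \<ge> 0"
  shows "op_exp (\<lambda>v. galerkin_proj n (lap v)) t v = heat t v"
proof -
  define G where "G = (\<lambda>v. galerkin_proj n (lap v))"
  \<comment> \<open>Membership in H_n goes through the induction because \<open>lap_coeff\<close>
    needs an argument in \<open>dom_lap\<close>.\<close>
  have G: "(G ^^ k) v \<in> galerkin_space n \<and>
      (\<forall>i. (G ^^ k) v \<bullet> ebasis (Suc i) = (- eigval (Suc i)) ^ k * (v \<bullet> ebasis (Suc i)))" for k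
  proof (induction k)
    case (Suc k)
    then have "(G ^^ k) v \<in> dom_lap"
      using galerkin_space_subset_dom_lap by blast
    with Suc v show ?case
      by (auto simp: G_def galerkin_proj_mem galerkin_proj_inner lap_coeff galerkin_space_iff)
  qed (use v in simp)
  have "(\<lambda>k. (t ^ k / fact k) *\<^sub>R (G ^^ k) v) sums heat t v"
  proof -
    have "heat t v \<in> galerkin_space n"
      using v t by (simp add: galerkin_space_iff heat_inner)
    from galerkin_space_expansion[OF this] have h: "heat t v =
        (\<Sum>i<n. (exp (- eigval (Suc i) * t) * (v \<bullet> ebasis (Suc i))) *\<^sub>R ebasis (Suc i))"
      using t by (simp add: heat_inner)
    have g: "(G ^^ k) v =
        (\<Sum>i<n. ((- eigval (Suc i)) ^ k * (v \<bullet> ebasis (Suc i))) *\<^sub>R ebasis (Suc i))" for k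
      using galerkin_space_expansion[of "(G ^^ k) v" n] G[of k] by simp
    have "(\<lambda>k. \<Sum>i<n. ((- eigval (Suc i) * t) ^ k /\<^sub>R fact k) *\<^sub>R (v \<bullet> ebasis (Suc i)) *\<^sub>R ebasis (Suc i))
       sums (\<Sum>i<n. exp (- eigval (Suc i) * t) *\<^sub>R (v \<bullet> ebasis (Suc i)) *\<^sub>R ebasis (Suc i))"
      by (intro sums_sum bounded_linear.sums[OF bounded_linear_scaleR_left] exp_converges)
    moreover have "(- eigval (Suc i) * t) ^ k = t ^ k * (- eigval (Suc i)) ^ k" for i k
      by (simp only: power_mult_distrib mult.commute)
    ultimately show ?thesis
      unfolding h g by (simp add: scaleR_sum_right divide_inverse mult_ac del: mult_minus_left)
  qed
  then show ?thesis
    unfolding op_exp_def G_def[symmetric] by (rule sums_unique[symmetric])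
qed

lemma has_bochner_integral_exp_affine:
  fixes a b :: real
  assumes "a \<noteq> 0" "T \<ge> 0"
  shows "has_bochner_integral (lebesgue_on {0<..<T}) (\<lambda>s. exp (a * s + b)) ((exp (a * T + b) - exp b) / a)"
proof -
  have "has_bochner_integral (lebesgue_on {0<..<T}) (\<lambda>s. exp (a * s + b)) (exp (a * T + b) / a - exp (a * 0 + b) / a)"
    by (rule has_bochner_integral_FTC_Ioo)
       (use assms in \<open>auto intro!: derivative_eq_intros continuous_intros\<close>)
  then show ?thesis by (simp add: diff_divide_distrib)
qed

lemma control_coeff_integrable:
  assumes "\<phi> \<in> controls X T"
  shows "integrable (lebesgue_on {0<..<T}) (\<lambda>s. (\<phi> s \<bullet> ebasis (Suc i))\<^sup>2)"
proof (rule Bochner_Integration.integrable_bound)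
  show "integrable (lebesgue_on {0<..<T}) (\<lambda>s. (norm (\<phi> s))\<^sup>2)"
    using assms by (simp add: controls_def)
  have [measurable]: "\<phi> \<in> borel_measurable (lebesgue_on {0<..<T})"
    using assms by (simp add: controls_def)
  show "(\<lambda>s. (\<phi> s \<bullet> ebasis (Suc i))\<^sup>2) \<in> borel_measurable (lebesgue_on {0<..<T})"
    by measurable
  have "(v \<bullet> ebasis (Suc i))\<^sup>2 \<le> (norm v)\<^sup>2" for v
    using Cauchy_Schwarz_ineq[of v "ebasis (Suc i)"] by (simp add: ebasis_norm power2_norm_eq_inner)
  then show "AE s in lebesgue_on {0<..<T}. norm ((\<phi> s \<bullet> ebasis (Suc i))\<^sup>2) \<le> norm ((norm (\<phi> s))\<^sup>2)"
    by simp
qed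

lemma galerkin_proj_controls:
  assumes "\<phi> \<in> controls X T"
  shows "(\<lambda>s. galerkin_proj n (\<phi> s)) \<in> controls (galerkin_space n) T"
    and "(LINT s|lebesgue_on {0<..<T}. (norm (galerkin_proj n (\<phi> s)))\<^sup>2)
      \<le> (LINT s|lebesgue_on {0<..<T}. (norm (\<phi> s))\<^sup>2)"
proof -
  let ?M = "lebesgue_on {0<..<T}"
  have [measurable]: "\<phi> \<in> borel_measurable ?M" and i: "integrable ?M (\<lambda>s. (norm (\<phi> s))\<^sup>2)"
    using assms by (simp_all add: controls_def)
  have m [measurable]: "(\<lambda>s. galerkin_proj n (\<phi> s)) \<in> borel_measurable ?M"
    by (rule borel_measurable_L2I) (simp add: galerkin_proj_inner)
  have le: "(norm (galerkin_proj n v))\<^sup>2 \<le> (norm v)\<^sup>2" for v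
    by (intro power_mono galerkin_proj_norm_le) simp
  have i': "integrable ?M (\<lambda>s. (norm (galerkin_proj n (\<phi> s)))\<^sup>2)"
    by (rule Bochner_Integration.integrable_bound[OF i]) (use le in auto)
  show "(\<lambda>s. galerkin_proj n (\<phi> s)) \<in> controls (galerkin_space n) T"
    using m i' by (simp add: controls_def galerkin_proj_mem)
  show "(LINT s|?M. (norm (galerkin_proj n (\<phi> s)))\<^sup>2) \<le> (LINT s|?M. (norm (\<phi> s))\<^sup>2)"
    by (intro integral_mono i i' le)
qed

text \<open>The semigroup acts only on 0 and on the range of P_n, where both semigroups agree.
  Galerkin paths can thus be treated as \<open>heat\<close> paths with the truncated control
  operator.\<close>

lemma mild_solution_galerkin_iff:
  "mild_solution (op_exp (\<lambda>v. galerkin_proj n (lap v))) (\<lambda>v. galerkin_proj n 0)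
      (\<lambda>v. galerkin_proj n (B v)) T 0 \<phi> z
    \<longleftrightarrow> mild_solution heat (\<lambda>v. 0) (\<lambda>v. galerkin_proj n (B v)) T 0 \<phi> z"
proof -
  have 0: "galerkin_proj n 0 = 0" by (simp add: galerkin_proj_def)
  have "0 \<in> galerkin_space n" by (simp add: galerkin_space_iff)
  then have op0: "op_exp (\<lambda>v. galerkin_proj n (lap v)) t 0 = heat t 0" if "t \<in> {0..T}" for t
    using that by (intro op_exp_galerkin) auto
  have eq: "op_exp (\<lambda>v. galerkin_proj n (lap v)) (t - s) (0 + galerkin_proj n (B (\<phi> s)))
      = heat (t - s) (0 + galerkin_proj n (B (\<phi> s)))" if "s \<in> {0<..<t}" for s t
    using that by (intro op_exp_galerkin) (auto simp: galerkin_proj_mem)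
  have "integrable (lebesgue_on {0<..<t})
        (\<lambda>s. op_exp (\<lambda>v. galerkin_proj n (lap v)) (t - s) (0 + galerkin_proj n (B (\<phi> s))))
      \<longleftrightarrow> integrable (lebesgue_on {0<..<t}) (\<lambda>s. heat (t - s) (0 + galerkin_proj n (B (\<phi> s))))" for t
    by (rule Bochner_Integration.integrable_cong[OF refl]) (use eq in auto)
  moreover have "(LINT s|lebesgue_on {0<..<t}.
        op_exp (\<lambda>v. galerkin_proj n (lap v)) (t - s) (0 + galerkin_proj n (B (\<phi> s))))
      = (LINT s|lebesgue_on {0<..<t}. heat (t - s) (0 + galerkin_proj n (B (\<phi> s))))" for t
    by (rule Bochner_Integration.integral_cong[OF refl]) (use eq in auto)
  ultimately show ?thesis
    using op0 unfolding mild_solution_def 0 by auto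
qed

section \<open>Diagonal control operators: lower energy bound\<close>

text \<open>The multiplier \<open>r i\<close> belongs to \<open>ebasis (Suc i)\<close>. The value 0
  is allowed, so that truncations are covered as well.\<close>

locale diagonal_operator =
  fixes B :: "L2 \<Rightarrow> L2" and r :: "nat \<Rightarrow> real"
  assumes bounded: "bounded_linear B"
    and coeff: "B v \<bullet> ebasis (Suc i) = r i * (v \<bullet> ebasis (Suc i))"
begin

text \<open>In one mode the endpoint is \<open>r i\<close> times the integral of the control against
  the heat kernel of that mode, whose square has integral below
  \<open>1 / (2 * eigval (Suc i))\<close>. Keeping \<open>r i\<close> on the right avoids division
  by zero.\<close>

lemma endpoint_coeff_le:
  assumes c: "\<phi> \<in> controls X T" and T: "T > 0"
    and m: "mild_solution heat (\<lambda>v. 0) B T 0 \<phi> z"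
  shows "eigval (Suc i) * (z T \<bullet> ebasis (Suc i))\<^sup>2
    \<le> (r i)\<^sup>2 * (1 / 2 * (LINT s|lebesgue_on {0<..<T}. (\<phi> s \<bullet> ebasis (Suc i))\<^sup>2))"
proof -
  define M where "M = lebesgue_on {0<..<T}"
  define l where "l = eigval (Suc i)"
  define g where "g s = exp (- l * (T - s))" for s
  define f where "f s = \<phi> s \<bullet> ebasis (Suc i)" for s
  have l: "l > 0" by (simp add: l_def eigval_pos)
  have [measurable]: "\<phi> \<in> borel_measurable M"
    using c by (simp add: controls_def M_def)
  have fm [measurable]: "f \<in> borel_measurable M"
    unfolding f_def by measurable
  have g2: "has_bochner_integral M (\<lambda>s. (g s)\<^sup>2) ((1 - exp (- 2 * l * T)) / (2 * l))"
    using has_bochner_integral_exp_affine[of "2 * l" T "- 2 * l * T"] l T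
    by (simp add: M_def g_def algebra_simps flip: exp_double)
  have gm [measurable]: "g \<in> borel_measurable M"
    unfolding M_def g_def
    by (intro continuous_imp_measurable_on_sets_lebesgue) (auto intro!: continuous_intros)
  have f2: "integrable M (\<lambda>s. (f s)\<^sup>2)"
    unfolding M_def f_def by (rule control_coeff_integrable[OF c])
  have gf: "integrable M (\<lambda>s. g s * f s)"
  proof (rule Bochner_Integration.integrable_bound)
    show "integrable M (\<lambda>s. (g s)\<^sup>2 + (f s)\<^sup>2)"
      using f2 g2 by (auto simp: has_bochner_integral_iff)
    have "\<bar>g s * f s\<bar> \<le> (g s)\<^sup>2 + (f s)\<^sup>2" for s
      using sum_squares_bound[of "\<bar>g s\<bar>" "\<bar>f s\<bar>"] mult_nonneg_nonneg[of "\<bar>g s\<bar>" "\<bar>f s\<bar>"]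
      unfolding abs_mult power2_abs by linarith
    then show "AE s in M. norm (g s * f s) \<le> norm ((g s)\<^sup>2 + (f s)\<^sup>2)" by simp
  qed measurable
  define Y where "Y = (LINT s|M. g s * f s)"
  \<comment> \<open>The coefficient functional passes under the Bochner integral, and the initial
    value 0 contributes nothing.\<close>
  have "z T \<bullet> ebasis (Suc i) = (LINT s|M. heat (T - s) (B (\<phi> s)) \<bullet> ebasis (Suc i))"
  proof -
    have "integrable M (\<lambda>s. heat (T - s) (0 + B (\<phi> s)))"
        "z T = heat T 0 + (LINT s|M. heat (T - s) (0 + B (\<phi> s)))"
      using m T by (auto simp: mild_solution_def M_def)
    moreover have "heat T 0 = 0"
      using linear_0[OF bounded_linear.linear[OF heat_bounded_linear]] T by simp
    ultimately show ?thesis by simp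
  qed
  also have "\<dots> = (LINT s|M. r i * (g s * f s))"
    by (rule Bochner_Integration.integral_cong)
       (auto simp: M_def heat_inner coeff g_def f_def l_def)
  finally have zY: "z T \<bullet> ebasis (Suc i) = r i * Y" by (simp add: Y_def)
  \<comment> \<open>Completing the square with the optimal multiplier \<open>2 * l * Y\<close> replaces the Cauchy--Schwarz inequality.\<close>
  have "0 \<le> (LINT s|M. (f s - (2 * l * Y) * g s)\<^sup>2)" by simp
  also have "\<dots> = (LINT s|M. (f s)\<^sup>2 - (4 * l * Y) * (g s * f s) + (4 * l\<^sup>2 * Y\<^sup>2) * (g s)\<^sup>2)"
    by (simp add: power2_eq_square algebra_simps)
  also have "\<dots> = (LINT s|M. (f s)\<^sup>2) - (4 * l * Y) * Y + (4 * l\<^sup>2 * Y\<^sup>2) * ((1 - exp (- 2 * l * T)) / (2 * l))"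
    using f2 gf g2 by (simp add: Y_def has_bochner_integral_iff)
  also have "(4 * l\<^sup>2 * Y\<^sup>2) * ((1 - exp (- 2 * l * T)) / (2 * l)) = 2 * l * Y\<^sup>2 * (1 - exp (- 2 * l * T))"
    using l by (simp add: power2_eq_square)
  \<comment> \<open>Dropping the exponential makes the bound independent of the horizon
    \<open>T\<close>.\<close>
  also have "\<dots> \<le> 2 * l * Y\<^sup>2 * 1"
    using l by (intro mult_left_mono) auto
  finally have "l * Y\<^sup>2 \<le> 1 / 2 * (LINT s|M. (f s)\<^sup>2)"
    by (simp add: power2_eq_square mult_ac)
  from mult_left_mono[OF this, of "(r i)\<^sup>2"] show ?thesis
    by (simp add: zY power_mult_distrib M_def f_def l_def mult.left_commute)
qed

text \<open>The bounds of the first n modes add up, and Bessel's inequality bounds the squared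
  control coefficients by the squared norm.\<close>

lemma endpoint_energy_le:
  assumes c: "\<phi> \<in> controls X T" and T: "T > 0"
    and m: "mild_solution heat (\<lambda>v. 0) B T 0 \<phi> z" and r: "\<And>i. i < n \<Longrightarrow> r i \<noteq> 0"
  shows "(\<Sum>i<n. eigval (Suc i) * (z T \<bullet> ebasis (Suc i))\<^sup>2 / (r i)\<^sup>2)
    \<le> 1 / 2 * (LINT s|lebesgue_on {0<..<T}. (norm (\<phi> s))\<^sup>2)"
proof -
  have "(\<Sum>i<n. eigval (Suc i) * (z T \<bullet> ebasis (Suc i))\<^sup>2 / (r i)\<^sup>2)
      \<le> (\<Sum>i<n. 1 / 2 * (LINT s|lebesgue_on {0<..<T}. (\<phi> s \<bullet> ebasis (Suc i))\<^sup>2))"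
    using endpoint_coeff_le[OF c T m] r
    by (intro sum_mono) (simp add: divide_le_eq mult.commute)
  also have "\<dots> = 1 / 2 * (LINT s|lebesgue_on {0<..<T}. (\<Sum>i<n. (\<phi> s \<bullet> ebasis (Suc i))\<^sup>2))"
    using control_coeff_integrable[OF c] by (simp add: Bochner_Integration.integral_sum sum_distrib_left)
  also have "\<dots> \<le> 1 / 2 * (LINT s|lebesgue_on {0<..<T}. (norm (\<phi> s))\<^sup>2)"
  proof (intro mult_left_mono integral_mono)
    show "(\<Sum>i<n. (\<phi> s \<bullet> ebasis (Suc i))\<^sup>2) \<le> (norm (\<phi> s))\<^sup>2" for s
      unfolding norm_ebasis_suminf by (rule sum_le_suminf[OF bessel_ebasis]) auto
  qed (use c control_coeff_integrable[OF c] in \<open>auto simp: controls_def\<close>)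
  finally show ?thesis .
qed

section \<open>Projection of controlled paths\<close>

lemma diagonal_operator_galerkin:
  "diagonal_operator (\<lambda>v. galerkin_proj n (B v)) (\<lambda>i. if i < n then r i else 0)"
  by (rule diagonal_operator.intro[OF bounded_linear_compose[OF bounded_linear_galerkin_proj bounded]])
     (simp add: galerkin_proj_inner coeff)

text \<open>P_n, \<open>B\<close> and \<open>heat\<close> commute, being diagonal in the same basis,
  and P_n is idempotent; so P_n applied to the integral equation gives that of the projected path
  and control.\<close>

lemma mild_solution_galerkin_proj:
  assumes m: "mild_solution heat (\<lambda>v. 0) B T 0 \<phi> z"
  shows "mild_solution heat (\<lambda>v. 0) (\<lambda>v. galerkin_proj n (B v)) T 0
    (\<lambda>s. galerkin_proj n (\<phi> s)) (\<lambda>t. galerkin_proj n (z t))"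
  unfolding mild_solution_def
proof (intro conjI ballI)
  show "continuous_on {0..T} (\<lambda>t. galerkin_proj n (z t))"
    using m unfolding mild_solution_def
    by (intro bounded_linear.continuous_on[OF bounded_linear_galerkin_proj]) simp
next
  fix t assume t: "t \<in> {0..T}"
  let ?M = "lebesgue_on {0<..<t}"
  have eq: "heat (t - s) (0 + galerkin_proj n (B (galerkin_proj n (\<phi> s))))
      = galerkin_proj n (heat (t - s) (0 + B (\<phi> s)))" if "s \<in> space ?M" for s
    using that by (intro L2_eqI) (simp add: galerkin_proj_inner heat_inner coeff)
  have i: "integrable ?M (\<lambda>s. heat (t - s) (0 + B (\<phi> s)))"
    and z: "z t = heat t 0 + (LINT s|?M. heat (t - s) (0 + B (\<phi> s)))"
    using m t by (auto simp: mild_solution_def)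
  show "integrable ?M (\<lambda>s. heat (t - s) (0 + galerkin_proj n (B (galerkin_proj n (\<phi> s)))))"
    using integrable_bounded_linear[OF bounded_linear_galerkin_proj i]
    by (simp only: eq cong: Bochner_Integration.integrable_cong)
  have "galerkin_proj n (heat t 0) = heat t 0"
    using t by (intro L2_eqI) (simp add: galerkin_proj_inner heat_inner)
  then show "galerkin_proj n (z t) = heat t 0
      + (LINT s|?M. heat (t - s) (0 + galerkin_proj n (B (galerkin_proj n (\<phi> s)))))"
    unfolding z
    by (simp only: linear_add[OF bounded_linear.linear[OF bounded_linear_galerkin_proj]]
        integral_bounded_linear[OF bounded_linear_galerkin_proj i, symmetric] eq
        cong: Bochner_Integration.integral_cong)
qed

text \<open>The drift stays in the form \<open>galerkin_proj n 0\<close>, to which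
  \<open>V_galerkin\<close> unfolds for F = 0.\<close>

abbreviation galerkin_potential :: "nat \<Rightarrow> L2 \<Rightarrow> ereal" where
  "galerkin_potential n \<equiv> quasi_potential (op_exp (\<lambda>v. galerkin_proj n (lap v)))
    (\<lambda>v. galerkin_proj n 0) (\<lambda>v. galerkin_proj n (B v)) (galerkin_space n)"

text \<open>Every competitor on the right projects to a competitor on the left, of no greater
  cost.\<close>

lemma galerkin_potential_le:
  "galerkin_potential n (galerkin_proj n u) \<le> quasi_potential heat (\<lambda>v. 0) B UNIV u"
proof (rule quasi_potential_geI)
  fix T :: real and z \<phi>
  assume a: "T > 0" "z 0 = 0" "z T = u" "\<phi> \<in> controls UNIV T" "mild_solution heat (\<lambda>v. 0) B T 0 \<phi> z"
  have "galerkin_potential n (galerkin_proj n u)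
      \<le> ereal (1 / 2 * (LINT s|lebesgue_on {0<..<T}. (norm (galerkin_proj n (\<phi> s)))\<^sup>2))"
  proof (rule quasi_potential_leI[where z = "\<lambda>t. galerkin_proj n (z t)"])
    show "mild_solution (op_exp (\<lambda>v. galerkin_proj n (lap v))) (\<lambda>v. galerkin_proj n 0)
        (\<lambda>v. galerkin_proj n (B v)) T 0 (\<lambda>s. galerkin_proj n (\<phi> s)) (\<lambda>t. galerkin_proj n (z t))"
      unfolding mild_solution_galerkin_iff by (rule mild_solution_galerkin_proj[OF a(5)])
  qed (use a galerkin_proj_controls[OF a(4)] in \<open>auto simp: galerkin_proj_mem galerkin_proj_def[of n 0]\<close>)
  also have "\<dots> \<le> ereal (1 / 2 * (LINT s|lebesgue_on {0<..<T}. (norm (\<phi> s))\<^sup>2))"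
    using galerkin_proj_controls(2)[OF a(4), of n] by simp
  finally show "galerkin_potential n (galerkin_proj n u)
      \<le> ereal (1 / 2 * (LINT s|lebesgue_on {0<..<T}. (norm (\<phi> s))\<^sup>2))" .
qed

text \<open>A Galerkin path is a \<open>heat\<close> path of the truncated operator, whose first n
  multipliers are those of \<open>B\<close>; so the endpoint estimate applies.\<close>

lemma energy_le_galerkin_potential:
  assumes r: "\<And>i. i < n \<Longrightarrow> r i \<noteq> 0"
  shows "ereal (\<Sum>i<n. eigval (Suc i) * (v \<bullet> ebasis (Suc i))\<^sup>2 / (r i)\<^sup>2) \<le> galerkin_potential n v"
proof (rule quasi_potential_geI)
  fix T :: real and z \<phi>
  assume a: "T > 0" "z T = v" "\<phi> \<in> controls (galerkin_space n) T"
    "mild_solution (op_exp (\<lambda>v. galerkin_proj n (lap v))) (\<lambda>v. galerkin_proj n 0)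
      (\<lambda>v. galerkin_proj n (B v)) T 0 \<phi> z"
  interpret G: diagonal_operator "\<lambda>v. galerkin_proj n (B v)" "\<lambda>i. if i < n then r i else 0"
    by (rule diagonal_operator_galerkin)
  show "ereal (\<Sum>i<n. eigval (Suc i) * (v \<bullet> ebasis (Suc i))\<^sup>2 / (r i)\<^sup>2)
      \<le> ereal (1 / 2 * (LINT s|lebesgue_on {0<..<T}. (norm (\<phi> s))\<^sup>2))"
    using G.endpoint_energy_le[OF a(3,1) a(4)[unfolded mild_solution_galerkin_iff], of n] r a(2)
    by simp
qed

section \<open>Upper energy bound\<close>

text \<open>In mode i the cheapest control costs the energy term divided by 1 - exp(-2 \<lambda>_i
  T). As every eigenvalue is at least 1, one denominator serves all modes.\<close>

lemma quasi_potential_le_energy_finite_horizon: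
  assumes r: "\<And>i. r i > 0" and T: "T > 0"
    and S: "(\<lambda>i. eigval (Suc i) * (u \<bullet> ebasis (Suc i))\<^sup>2 / (r i)\<^sup>2) sums S"
  shows "quasi_potential heat (\<lambda>v. 0) B UNIV u \<le> ereal (S / (1 - exp (- 2 * T)))"
proof -
  \<comment> \<open>\<open>\<phi>\<close> is the control of least energy among those steering every mode from \<open>0\<close> to \<open>x i\<close> in time \<open>T\<close>,
    and \<open>z\<close> is its trajectory. Its coefficients need not be square summable at \<open>s = T\<close>.\<close>
  define M where "M = lebesgue_on {0<..<T}"
  define l where "l i = eigval (Suc i)" for i
  define x where "x i = u \<bullet> ebasis (Suc i)" for i
  define D where "D i = 1 - exp (- 2 * l i * T)" for i
  \<comment> \<open>Solves \<open>r i * c i * D i / (2 * l i) = x i\<close>, whose left side is the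
    endpoint reached in mode \<open>i\<close>.\<close>
  define c where "c i = 2 * l i * x i / (r i * D i)" for i
  define \<phi> where "\<phi> s = (\<Sum>i. (c i * exp (- l i * (T - s))) *\<^sub>R ebasis (Suc i))" for s
  define a where "a t i = sinh (eigval i * t) / sinh (eigval i * T)" for t i
  define z where "z t = diag_op (a t) u" for t
  define D0 where "D0 = 1 - exp (- 2 * T)"
  have l1: "l i \<ge> 1" for i by (simp add: l_def eigval_ge_1)
  then have l0: "l i > 0" for i by (rule less_le_trans[OF zero_less_one])
  have D0: "D0 > 0" using T by (simp add: D0_def)
  have D: "D0 \<le> D i" for i using l1[of i] T by (simp add: D0_def D_def)
  have Dpos: "D i > 0" for i using D0 D[of i] by simp
  have E: "(\<lambda>i. l i * (x i)\<^sup>2 / (r i)\<^sup>2) sums S"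
    using S by (simp add: l_def x_def)
  have sq: "(c i * exp (- l i * (T - s)))\<^sup>2
      = 4 * (l i * (x i)\<^sup>2 / (r i)\<^sup>2) * (l i * exp (- 2 * l i * (T - s))) / (D i)\<^sup>2" for i s
    by (simp add: c_def power_mult_distrib power_divide power2_eq_square[of "l i"] flip: exp_double)
  \<comment> \<open>The energy terms are summable; the surplus factor \<open>l i\<close> is absorbed
    by the exponential, with a constant that blows up as \<open>s\<close> tends to
    \<open>T\<close>.\<close>
  have summ: "summable (\<lambda>i. (c i * exp (- l i * (T - s)))\<^sup>2)" if "s < T" for s
  proof (rule summable_comparison_test')
    show "summable (\<lambda>i. 4 / (D0\<^sup>2 * (T - s)) * (l i * (x i)\<^sup>2 / (r i)\<^sup>2))"
      using E by (intro summable_mult) (rule sums_summable)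
    fix i
    \<comment> \<open>The chain is \<open>y \<le> exp y \<le> exp (2 * y)\<close> with
      \<open>y = (T - s) * l i\<close>.\<close>
    have "(T - s) * l i \<le> exp ((T - s) * l i)"
      using exp_ge_add_one_self[of "(T - s) * l i"] by linarith
    also have "\<dots> \<le> exp (2 * l i * (T - s))"
      using that l0[of i] by simp
    finally have "(T - s) * l i * exp (- (2 * l i * (T - s))) \<le> 1"
      by (simp only: exp_minus flip: divide_inverse) (simp add: divide_le_eq)
    then have "l i * exp (- 2 * l i * (T - s)) \<le> 1 / (T - s)"
      using that by (simp add: pos_le_divide_eq mult_ac)
    moreover have "1 / (D i)\<^sup>2 \<le> 1 / D0\<^sup>2"
      using D0 D[of i] by (intro divide_left_mono power_mono) auto
    ultimately have "(l i * exp (- 2 * l i * (T - s))) * (1 / (D i)\<^sup>2) \<le> 1 / (T - s) * (1 / D0\<^sup>2)"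
      using that by (intro mult_mono) auto
    moreover have "0 \<le> 4 * (l i * (x i)\<^sup>2 / (r i)\<^sup>2)"
      using l0[of i] by simp
    ultimately have "4 * (l i * (x i)\<^sup>2 / (r i)\<^sup>2) * ((l i * exp (- 2 * l i * (T - s))) * (1 / (D i)\<^sup>2))
        \<le> 4 * (l i * (x i)\<^sup>2 / (r i)\<^sup>2) * (1 / (T - s) * (1 / D0\<^sup>2))"
      by (rule mult_left_mono)
    then have "(c i * exp (- l i * (T - s)))\<^sup>2 \<le> 4 / (D0\<^sup>2 * (T - s)) * (l i * (x i)\<^sup>2 / (r i)\<^sup>2)"
      unfolding sq by (simp add: mult_ac)
    then show "norm ((c i * exp (- l i * (T - s)))\<^sup>2) \<le> 4 / (D0\<^sup>2 * (T - s)) * (l i * (x i)\<^sup>2 / (r i)\<^sup>2)"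
      by simp
  qed
  have phi: "\<phi> s \<bullet> ebasis (Suc i) = c i * exp (- l i * (T - s))" if "s < T" for s i
    unfolding \<phi>_def by (rule inner_suminf_ebasis[OF summ[OF that]])
  have em: "(\<lambda>s. c i * exp (- l i * (T - s))) \<in> borel_measurable (lebesgue_on {0<..<t})" for i t
    by (intro continuous_imp_measurable_on_sets_lebesgue) (auto intro!: continuous_intros)
  have phim: "\<phi> \<in> borel_measurable (lebesgue_on {0<..<t})" for t
    unfolding \<phi>_def using em by measurable
  have int: "has_bochner_integral M (\<lambda>s. (c i * exp (- l i * (T - s)))\<^sup>2)
      (2 * (l i * (x i)\<^sup>2 / (r i)\<^sup>2) / D i)" for i
  proof -
    have "has_bochner_integral M (\<lambda>s. exp (2 * l i * s + - 2 * l i * T)) (D i / (2 * l i))"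
      using has_bochner_integral_exp_affine[of "2 * l i" T "- 2 * l i * T"] l0[of i] T
      by (simp add: M_def D_def)
    from has_bochner_integral_mult_right[OF this, of "(c i)\<^sup>2"]
    have "has_bochner_integral M (\<lambda>s. (c i)\<^sup>2 * exp (2 * l i * s + - 2 * l i * T)) ((c i)\<^sup>2 * (D i / (2 * l i)))"
      by simp
    moreover have "(c i)\<^sup>2 * (D i / (2 * l i)) = 2 * (l i * (x i)\<^sup>2 / (r i)\<^sup>2) / D i"
      using l0[of i] Dpos[of i] r[of i] by (simp add: c_def power2_eq_square)
    moreover have "(c i)\<^sup>2 * exp (2 * l i * s + - 2 * l i * T) = (c i * exp (- l i * (T - s)))\<^sup>2" for s
      by (simp add: power_mult_distrib algebra_simps flip: exp_double)
    ultimately show ?thesis by simp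
  qed
  have le: "2 * (l i * (x i)\<^sup>2 / (r i)\<^sup>2) / D i \<le> 2 / D0 * (l i * (x i)\<^sup>2 / (r i)\<^sup>2)" for i
    using divide_left_mono[OF D[of i], of "2 * (l i * (x i)\<^sup>2 / (r i)\<^sup>2)"] l0[of i] Dpos[of i] D0
    by (simp add: mult_ac)
  have sI: "summable (\<lambda>i. 2 * (l i * (x i)\<^sup>2 / (r i)\<^sup>2) / D i)"
  proof (rule summable_comparison_test')
    show "summable (\<lambda>i. 2 / D0 * (l i * (x i)\<^sup>2 / (r i)\<^sup>2))"
      using E by (intro summable_mult) (rule sums_summable)
    show "norm (2 * (l i * (x i)\<^sup>2 / (r i)\<^sup>2) / D i) \<le> 2 / D0 * (l i * (x i)\<^sup>2 / (r i)\<^sup>2)" for i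
      using le[of i] l0[of i] Dpos[of i] by simp
  qed
  have norm_phi: "(norm (\<phi> s))\<^sup>2 = (\<Sum>i. (c i * exp (- l i * (T - s)))\<^sup>2)" if "s \<in> space M" for s
    using that unfolding norm_ebasis_suminf by (simp add: phi M_def)
  \<comment> \<open>Sum and integral may be exchanged since the integrals of the nonnegative terms
    are summable.\<close>
  have suminf: "integrable M (\<lambda>s. \<Sum>i. (c i * exp (- l i * (T - s)))\<^sup>2)"
    "(LINT s|M. (\<Sum>i. (c i * exp (- l i * (T - s)))\<^sup>2)) = (\<Sum>i. 2 * (l i * (x i)\<^sup>2 / (r i)\<^sup>2) / D i)"
  proof -
    have 1: "integrable M (\<lambda>s. (c i * exp (- l i * (T - s)))\<^sup>2)" for i
      using int[of i] by (simp add: has_bochner_integral_iff)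
    have 2: "AE s in M. summable (\<lambda>i. norm ((c i * exp (- l i * (T - s)))\<^sup>2))"
      using summ by (intro AE_I2) (simp add: M_def)
    have 3: "summable (\<lambda>i. LINT s|M. norm ((c i * exp (- l i * (T - s)))\<^sup>2))"
      using sI int by (simp add: has_bochner_integral_iff)
    show "integrable M (\<lambda>s. \<Sum>i. (c i * exp (- l i * (T - s)))\<^sup>2)"
      by (rule integrable_suminf[OF 1 2 3])
    show "(LINT s|M. (\<Sum>i. (c i * exp (- l i * (T - s)))\<^sup>2)) = (\<Sum>i. 2 * (l i * (x i)\<^sup>2 / (r i)\<^sup>2) / D i)"
      using int by (subst integral_suminf[OF 1 2 3]) (simp add: has_bochner_integral_iff)
  qed
  have phi_int: "integrable M (\<lambda>s. (norm (\<phi> s))\<^sup>2)"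
    using suminf(1) by (simp only: norm_phi cong: Bochner_Integration.integrable_cong)
  have ctrl: "\<phi> \<in> controls UNIV T"
    using phi_int phim[of T] by (simp add: controls_def M_def)
  have cost: "1 / 2 * (LINT s|M. (norm (\<phi> s))\<^sup>2) \<le> S / D0"
  proof -
    have "(LINT s|M. (norm (\<phi> s))\<^sup>2) = (\<Sum>i. 2 * (l i * (x i)\<^sup>2 / (r i)\<^sup>2) / D i)"
      using suminf(2) by (simp only: norm_phi cong: Bochner_Integration.integral_cong)
    also have "\<dots> \<le> 2 / D0 * S"
      using sums_le[OF le summable_sums[OF sI] sums_mult[OF E]] .
    finally show ?thesis by (simp add: mult.commute)
  qed
  \<comment> \<open>At index 0 the eigenvalue is 0 and the quotient 0/0 takes the value 0.\<close>
  have abnd: "\<bar>a t i\<bar> \<le> 1" if "t \<in> {0..T}" for t i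
  proof (cases "eigval i = 0")
    case False
    then have "eigval i > 0" by (simp add: eigval_def)
    then show ?thesis using that T by (simp add: a_def divide_le_eq)
  qed (simp add: a_def)
  have zi: "z t \<bullet> ebasis (Suc i) = a t (Suc i) * x i" if "t \<in> {0..T}" for t i
    unfolding z_def x_def
    by (rule diag_op_inner[OF diag_dom_mono[OF diag_dom_1]]) (rule abnd[OF that])
  have z0: "z 0 = 0"
    using T by (intro L2_eqI) (simp add: zi a_def)
  have zT: "z T = u"
    using T l0 by (intro L2_eqI) (simp add: zi a_def x_def l_def less_imp_neq[symmetric])
  have zcont: "continuous_on {0..T} z"
    unfolding continuous_on_def
  proof
    fix t assume t: "t \<in> {0..T}"
    \<comment> \<open>The uniform bound 1 on the multipliers passes continuity from the modes to the
      sum. \<open>diag_op_tendsto\<close> needs a nontrivial filter; along the trivial one every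
      limit holds.\<close>
    show "(z \<longlongrightarrow> z t) (at t within {0..T})"
    proof (cases "at t within {0..T} = bot")
      case False
      show ?thesis
        unfolding z_def[abs_def]
      proof (rule diag_op_tendsto[OF _ _ diag_dom_1 False])
        show "((\<lambda>s. a s (Suc i)) \<longlongrightarrow> a t (Suc i)) (at t within {0..T})" for i
          unfolding a_def using l0[of i] T by (auto intro!: tendsto_intros simp: l_def)
        show "\<forall>\<^sub>F s in at t within {0..T}. \<forall>i. \<bar>a s (Suc i)\<bar> \<le> 1"
          unfolding eventually_at_filter using abnd by (intro always_eventually) simp
      qed
    qed simp
  qed
  have "mild_solution heat (\<lambda>v. 0) B T 0 \<phi> z"
    unfolding mild_solution_def
  proof (intro conjI ballI zcont)
    fix t assume t: "t \<in> {0..T}"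
    define N where "N = lebesgue_on {0<..<t}"
    define h where "h s = heat (t - s) (0 + B (\<phi> s))" for s
    \<comment> \<open>The exponents of semigroup and control add up; \<open>s < t \<le> T\<close>
      makes the coefficients of the control available.\<close>
    have hi: "h s \<bullet> ebasis (Suc i) = r i * c i * exp (2 * l i * s + - l i * (t + T))"
      if "s \<in> space N" for s i
      using that t by (simp add: h_def N_def heat_inner coeff phi algebra_simps flip: exp_add l_def)
    have hm: "h \<in> borel_measurable N"
    proof (rule borel_measurable_L2I)
      fix i
      have "(\<lambda>s. r i * c i * exp (2 * l i * s + - l i * (t + T))) \<in> borel_measurable N"
        unfolding N_def
        by (intro continuous_imp_measurable_on_sets_lebesgue) (auto intro!: continuous_intros)
      then show "(\<lambda>s. h s \<bullet> ebasis (Suc i)) \<in> borel_measurable N"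
        by (simp only: hi cong: measurable_cong)
    qed
    obtain K where K: "K > 0" "\<And>v. norm (B v) \<le> norm v * K"
      using bounded_linear.pos_bounded[OF bounded] by blast
    have hint: "integrable N h"
    proof (rule Bochner_Integration.integrable_bound)
      have "integrable N (\<lambda>s. (norm (\<phi> s))\<^sup>2)"
      proof -
        have "set_integrable lebesgue {0<..<T} (\<lambda>s. (norm (\<phi> s))\<^sup>2)"
          using phi_int by (simp add: M_def integrable_restrict_space set_integrable_def)
        then have "set_integrable lebesgue {0<..<t} (\<lambda>s. (norm (\<phi> s))\<^sup>2)"
          by (rule set_integrable_subset) (use t in auto)
        then show ?thesis
          by (simp add: N_def integrable_restrict_space set_integrable_def)
      qed
      moreover have "finite_measure N"
        by (rule finite_measureI) (use t in \<open>simp add: N_def emeasure_restrict_space\<close>)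
      ultimately show "integrable N (\<lambda>s. K * (1 + (norm (\<phi> s))\<^sup>2))"
        by (intro Bochner_Integration.integrable_add integrable_mult_right finite_measure.integrable_const)
      \<comment> \<open>Only the square of the norm of the control is known to be integrable, so the
        norm is majorised by 1 plus its square.\<close>
      have "norm (h s) \<le> K * (1 + (norm (\<phi> s))\<^sup>2)" if "s \<in> space N" for s
      proof -
        have "norm (h s) \<le> 1 * norm (B (\<phi> s))"
          using that heat_bound[of "t - s"]
          by (intro norm_mono_coeff) (auto simp: h_def N_def heat_inner abs_mult intro!: mult_left_le_one_le)
        also have "\<dots> \<le> K * norm (\<phi> s)" using K(2)[of "\<phi> s"] by (simp add: mult.commute)
        also have "\<dots> \<le> K * (1 + (norm (\<phi> s))\<^sup>2)"
        proof (rule mult_left_mono)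
          show "norm (\<phi> s) \<le> 1 + (norm (\<phi> s))\<^sup>2"
            using sum_squares_bound[of 1 "norm (\<phi> s)"] norm_ge_zero[of "\<phi> s"]
            unfolding power_one mult_1_right by linarith
        qed (use K(1) in simp)
        finally show ?thesis .
      qed
      then show "AE s in N. norm (h s) \<le> norm (K * (1 + (norm (\<phi> s))\<^sup>2))"
        using K(1) by (intro AE_I2) simp
    qed (rule hm)
    then show "integrable (lebesgue_on {0<..<t}) (\<lambda>s. heat (t - s) (0 + B (\<phi> s)))"
      by (simp add: h_def[abs_def] N_def)
    have "z t = heat t 0 + (LINT s|N. h s)"
    proof (rule L2_eqI)
      fix i
      have sh: "sinh (l i * T) > 0" using l0[of i] T by simp
      have "(LINT s|N. h s) \<bullet> ebasis (Suc i) = (LINT s|N. h s \<bullet> ebasis (Suc i))"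
        using hint by simp
      also have "\<dots> = (LINT s|N. r i * c i * exp (2 * l i * s + - l i * (t + T)))"
        by (simp only: hi cong: Bochner_Integration.integral_cong)
      also have "\<dots> = r i * c i * ((exp (2 * l i * t + - l i * (t + T)) - exp (- l i * (t + T))) / (2 * l i))"
        using has_bochner_integral_exp_affine[of "2 * l i" t "- l i * (t + T)"] l0[of i] t
        by (simp add: N_def has_bochner_integral_iff)
      \<comment> \<open>This difference and \<open>D i\<close> are both
        \<open>2 * exp (- l i * T)\<close> times a hyperbolic sine, at \<open>t\<close> and at
        \<open>T\<close>; their quotient is the multiplier \<open>a t (Suc i)\<close>.\<close>
      also have "exp (2 * l i * t + - l i * (t + T)) - exp (- l i * (t + T)) = 2 * exp (- l i * T) * sinh (l i * t)"
        by (simp add: sinh_def right_diff_distrib flip: exp_add) (simp add: algebra_simps)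
      also have "r i * c i * (2 * exp (- l i * T) * sinh (l i * t) / (2 * l i))
          = 2 * x i * exp (- l i * T) * sinh (l i * t) / D i"
        using l0[of i] r[of i] by (simp add: c_def)
      also have "D i = 2 * exp (- l i * T) * sinh (l i * T)"
        by (simp add: D_def sinh_def right_diff_distrib flip: exp_add)
      finally have "(LINT s|N. h s) \<bullet> ebasis (Suc i) = a t (Suc i) * x i"
        by (simp add: a_def l_def)
      then show "z t \<bullet> ebasis (Suc i) = (heat t 0 + (LINT s|N. h s)) \<bullet> ebasis (Suc i)"
        using t by (simp add: zi inner_add_left heat_inner)
    qed
    then show "z t = heat t 0 + (LINT s|lebesgue_on {0<..<t}. heat (t - s) (0 + B (\<phi> s)))"
      by (simp add: h_def[abs_def] N_def)
  qed
  from quasi_potential_leI[OF T _ z0 zT ctrl this] cost show ?thesis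
    by (simp add: M_def D0_def order_trans[OF _ ereal_less_eq(3)[THEN iffD2]])
qed

text \<open>The horizon is free in the quasi-potential, so it may tend to infinity in the previous
  bound.\<close>

lemma quasi_potential_le_energy:
  assumes r: "\<And>i. r i > 0"
    and S: "(\<lambda>i. eigval (Suc i) * (u \<bullet> ebasis (Suc i))\<^sup>2 / (r i)\<^sup>2) sums S"
  shows "quasi_potential heat (\<lambda>v. 0) B UNIV u \<le> ereal S"
proof (rule tendsto_lowerbound)
  have "((\<lambda>T. S / (1 - exp (- 2 * T))) \<longlongrightarrow> S / (1 - 0)) at_top"
    by (intro tendsto_intros filterlim_compose[OF exp_at_bot])
       (auto simp: filterlim_uminus_at_bot intro!: filterlim_tendsto_pos_mult_at_top[of _ 2] filterlim_ident)
  then show "((\<lambda>T. ereal (S / (1 - exp (- 2 * T)))) \<longlongrightarrow> ereal S) at_top" by simp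
  show "\<forall>\<^sub>F T in at_top. quasi_potential heat (\<lambda>v. 0) B UNIV u \<le> ereal (S / (1 - exp (- 2 * T)))"
    using eventually_gt_at_top[of 0]
    by eventually_elim (rule quasi_potential_le_energy_finite_horizon[OF r _ S])
qed simp

section \<open>Convergence of the rate functions\<close>

text \<open>A finite value bounds all partial sums of the energy, so the series converges, and a
  tail below \<kappa> controls the gap.\<close>

lemma galerkin_potential_approx:
  assumes r: "\<And>i. r i > 0" and fin: "quasi_potential heat (\<lambda>v. 0) B UNIV u < \<infinity>" and \<kappa>: "\<kappa> > 0"
  shows "\<forall>\<^sub>F n in sequentially.
    \<bar>quasi_potential heat (\<lambda>v. 0) B UNIV u - galerkin_potential n (galerkin_proj n u)\<bar> < ereal \<kappa>"
proof -
  let ?V = "quasi_potential heat (\<lambda>v. 0) B UNIV u"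
  let ?W = "\<lambda>n. galerkin_potential n (galerkin_proj n u)"
  define E where "E i = eigval (Suc i) * (u \<bullet> ebasis (Suc i))\<^sup>2 / (r i)\<^sup>2" for i
  have E0: "E i \<ge> 0" for i
    using eigval_ge_1[of i] by (simp add: E_def)
  have low: "ereal (\<Sum>i<n. E i) \<le> ?W n" for n
    using energy_le_galerkin_potential[of n "galerkin_proj n u"] r
    by (simp add: E_def galerkin_proj_inner less_imp_neq[symmetric])
  have up: "?W n \<le> ?V" for n by (rule galerkin_potential_le)
  \<comment> \<open>The empty sum at \<open>n = 0\<close> gives the lower bound 0, which excludes
    -\<infinity>.\<close>
  obtain v where v: "?V = ereal v"
    using low[of 0] up[of 0] fin by (cases ?V) auto
  have "summable E"
  proof (rule summableI_nonneg_bounded[OF E0])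
    show "(\<Sum>i<n. E i) \<le> v" for n
      using order_trans[OF low up, of n] v by simp
  qed
  then have S: "E sums suminf E" by (rule summable_sums)
  have vS: "v \<le> suminf E"
    using quasi_potential_le_energy[OF r S[unfolded E_def[abs_def]]] by (simp add: v E_def[abs_def])
  have "\<forall>\<^sub>F n in sequentially. suminf E - \<kappa> < (\<Sum>i<n. E i)"
    using S \<kappa> unfolding sums_def by (intro order_tendstoD) auto
  then show ?thesis
  proof eventually_elim
    case (elim n)
    \<comment> \<open>The chain is \<open>suminf E - \<kappa> < (\<Sum>i<n. E i) \<le> ?W n \<le> v
      \<le> suminf E\<close>, which also makes \<open>?W n\<close> finite.\<close>
    with low[of n] up[of n] vS v show ?case
      by (cases "?W n") auto
  qed
qed

end

theorem theorem3p13: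
  fixes Q F :: "L2 \<Rightarrow> L2" and q :: "nat \<Rightarrow> real" and L_F L :: real
  assumes "bounded_linear Q" and "self_adjoint Q" and "\<And>u. u \<noteq> 0 \<Longrightarrow> 0 < Q u \<bullet> u"
    and "\<And>i. i \<ge> 1 \<Longrightarrow> Q (ebasis i) = q i *\<^sub>R ebasis i" and "\<And>i. i \<ge> 1 \<Longrightarrow> q i > 0"
    and "dom_lap \<subseteq> range (sqrt_op Q)"
    and "range (sqrt_op Q) \<subseteq> frac_dom (1 / 2)"
    and "hilbert_schmidt (\<lambda>u. frac_pow (1 / 2) (sqrt_op Q u))"
    and "bounded_linear (\<lambda>u. inv (sqrt_op Q) (inv_into dom_lap (\<lambda>v. - lap v) u))"
    and "\<And>u. F differentiable (at u)"
    and "L_F > 0" and "L > 0"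
    and "\<And>u v. norm (F u - F v) \<le> L_F * norm (u - v)"
    and "\<And>u. u \<in> hdot 1 \<Longrightarrow> F u \<in> hdot 1 \<and> hdot_norm 1 (F u) \<le> L * (1 + hdot_norm 1 u)"
    and "\<And>u v. u \<in> hdot 2 \<Longrightarrow> v \<in> hdot 2 \<Longrightarrow>
           frechet_derivative F (at u) v \<in> hdot 2 \<and>
           hdot_norm 2 (frechet_derivative F (at u) v) \<le> L * (1 + (hdot_norm 2 u)\<^sup>2) * hdot_norm 2 v"
    and "F 0 = 0" and "L_F < eigval 1"
    and "F = (\<lambda>u. 0)"
  shows "\<forall>\<kappa> > 0. \<forall>u. V_rate Q F u < \<infinity> \<longrightarrow>
           (\<exists>n \<ge> 1. \<exists>u\<^sub>n \<in> galerkin_space n.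
              norm (u - u\<^sub>n) < \<kappa> \<and> \<bar>V_rate Q F u - V_galerkin n Q F u\<^sub>n\<bar> < ereal \<kappa>)"
proof (intro allI impI)
  fix \<kappa> :: real and u
  assume \<kappa>: "\<kappa> > 0" and fin: "V_rate Q F u < \<infinity>"
  note R = sqrt_op_correct[OF assms(1,2,4,5)]
  \<comment> \<open>The locale counts modes from 0 and the basis from 1; the squared multipliers are
    the eigenvalues of \<open>Q\<close>.\<close>
  interpret diagonal_operator "sqrt_op Q" "\<lambda>i. sqrt (q (Suc i))"
  proof (rule diagonal_operator.intro)
    show "bounded_linear (sqrt_op Q)" using R(1) by (simp add: is_sqrt_op_def)
    show "sqrt_op Q v \<bullet> ebasis (Suc i) = sqrt (q (Suc i)) * (v \<bullet> ebasis (Suc i))" for v i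
      using R(1) R(2)[of "Suc i"] by (simp add: is_sqrt_op_def self_adjoint_def)
  qed
  have "\<forall>\<^sub>F n in sequentially. \<bar>V_rate Q F u - V_galerkin n Q F (galerkin_proj n u)\<bar> < ereal \<kappa>"
    using galerkin_potential_approx[OF _ _ \<kappa>, of u] assms(5) fin
    by (simp add: V_rate_def V_galerkin_def assms(18))
  moreover have "\<forall>\<^sub>F n in sequentially. norm (u - galerkin_proj n u) < \<kappa>"
    using tendstoD[OF galerkin_proj_tendsto \<kappa>, of u] by (simp add: dist_norm norm_minus_commute)
  \<comment> \<open>Both approximations hold for all large \<open>n\<close>, hence for a common
    positive one.\<close>
  ultimately have "\<forall>\<^sub>F n in sequentially. n \<ge> 1 \<and> norm (u - galerkin_proj n u) < \<kappa> \<and>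
      \<bar>V_rate Q F u - V_galerkin n Q F (galerkin_proj n u)\<bar> < ereal \<kappa>"
    using eventually_ge_at_top[of 1] by eventually_elim simp
  then obtain n where "n \<ge> 1" "norm (u - galerkin_proj n u) < \<kappa>"
      "\<bar>V_rate Q F u - V_galerkin n Q F (galerkin_proj n u)\<bar> < ereal \<kappa>"
    by (auto simp: eventually_sequentially)
  then show "\<exists>n \<ge> 1. \<exists>u\<^sub>n \<in> galerkin_space n.
      norm (u - u\<^sub>n) < \<kappa> \<and> \<bar>V_rate Q F u - V_galerkin n Q F u\<^sub>n\<bar> < ereal \<kappa>"
    using galerkin_proj_mem by blast
qed

end
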